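(* Let $M$ be a contractible supermanifold, $\mathfrak g$ a Lie superalgebra with Lie supergroup $G$, and let $\omega\in\Omega^{\mathrm{odd}}(M,\mathfrak g)$ satisfy the Maurer–Cartan equation $d\omega+\omega^2=0$. Suppose that $$\omega=gCg^{-1}-dg\,g^{-1}$$ with $g\in\Omega^{\mathrm{even}}(M,G)$ and a constant odd element $C\in\mathfrak g_{\bar1}$. Then $$C^2=0\qquad(\text{i.e. } [C,C]=0),$$ that is, $C$ is a homological element of the Lie superalgebra $\mathfrak g$.
   Context: Conventions. Forms on a supermanifold $M$ are (pseudo)differential forms, i.e. functions on the supermanifold $\Pi TM$ (the tangent bundle with reversed fiber parity, with coordinates $x^a,dx^a$); they need not be homogeneous in form degree. $\Omega(M,\mathfrak g)$ denotes forms with values in the Lie superalgebra $\mathfrak g$; "odd" and "even" refer to total parity (parity of the form, $dx^a$ having parity opposite to $x^a$, plus parity in $\mathfrak g$). The exterior differential $d$ is the odd vector field $dx^a\,\partial/\partial x^a$ on $\Pi TM$. $\Omega^{\mathrm{even}}(M,G)$ is the group of even $G$-valued forms, defined as the group of supermanifold maps $\Pi TM\to G$. Formulas are written as for matrix (super)groups and are to be understood abstractly: $\omega^2:=\tfrac12[\omega,\omega]$ for odd $\omega$; $g\sigma g^{-1}:=\mathrm{Ad}(g)\sigma$; $dg\,g^{-1}$ is the odd $\mathfrak g$-valued form obtained by applying $d$ to $g\colon\Pi TM\to G$ and translating to the identity by right translation. $\mathfrak g_{\bar 1}$ is the odd part of $\mathfrak g$; its elements are regarded as constant odd $\mathfrak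 g$-valued forms. *)

theory Defs
  imports "HOL-Analysis.Analysis"
begin

section \<open>Grassmann algebra\<close>

text \<open>The real Grassmann algebra on generators \<open>\<theta>\<^sub>0, \<theta>\<^sub>1, \<dots>\<close>.  An element is given by its
  coefficients at the monomials \<open>\<theta>\<^sub>K\<close>, the product of the \<open>\<theta>\<^sub>k\<close> (\<open>k \<in> K\<close>) in increasing order.
  Infinite sums of monomials are allowed in the type; only the subalgebras \<open>grass q\<close> of elements
  in finitely many generators are used below.\<close>

typedef gr = "{a :: nat set \<Rightarrow> real. \<forall>K. infinite K \<longrightarrow> a K = 0}"
  morphisms coeff Gr
  by (rule exI[of _ "\<lambda>_. 0"]) simp

lemma coeff_infinite [simp]: "infinite K \<Longrightarrow> coeff a K = 0"
  using coeff[of a] by blast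

lemma coeff_Gr: "coeff (Gr f) K = f K" if "\<And>K. infinite K \<Longrightarrow> f K = 0"
  using that by (subst Gr_inverse) auto

lemma gr_eqI: "(\<And>K. finite K \<Longrightarrow> coeff a K = coeff b K) \<Longrightarrow> a = b"
  by (metis coeff_inject coeff_infinite ext)

definition gsign :: "nat set \<Rightarrow> nat set \<Rightarrow> real" where
  "gsign I J = (- 1) ^ card {(i, j). i \<in> I \<and> j \<in> J \<and> j < i}"

lemma finite_inv_pairs: "finite I \<Longrightarrow> finite J \<Longrightarrow> finite {(i, j). i \<in> I \<and> j \<in> J \<and> j < (i::nat)}"
  by (rule finite_subset[of _ "I \<times> J"]) auto

lemma gsign_Un_left:
  assumes "finite I" "finite J" "finite L" "I \<inter> J = {}"
  shows "gsign (I \<union> J) L = gsign I L * gsign J L"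
proof -
  have "{(i, j). i \<in> I \<union> J \<and> j \<in> L \<and> j < i}
      = {(i, j). i \<in> I \<and> j \<in> L \<and> j < i} \<union> {(i, j). i \<in> J \<and> j \<in> L \<and> j < i}" by auto
  moreover have "{(i, j). i \<in> I \<and> j \<in> L \<and> j < i} \<inter> {(i, j). i \<in> J \<and> j \<in> L \<and> j < i} = {}"
    using assms by auto
  ultimately show ?thesis
    using assms by (simp add: gsign_def card_Un_disjoint finite_inv_pairs power_add)
qed

lemma gsign_Un_right:
  assumes "finite I" "finite J" "finite L" "J \<inter> L = {}"
  shows "gsign I (J \<union> L) = gsign I J * gsign I L"
proof -
  have "{(i, j). i \<in> I \<and> j \<in> J \<union> L \<and> j < i}
      = {(i, j). i \<in> I \<and> j \<in> J \<and> j < i} \<union> {(i, j). i \<in> I \<and> j \<in> L \<and> j < i}" by auto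
  moreover have "{(i, j). i \<in> I \<and> j \<in> J \<and> j < i} \<inter> {(i, j). i \<in> I \<and> j \<in> L \<and> j < i} = {}"
    using assms by auto
  ultimately show ?thesis
    using assms by (simp add: gsign_def card_Un_disjoint finite_inv_pairs power_add)
qed

lemma gsign_empty [simp]: "gsign {} J = 1" "gsign I {} = 1"
  by (simp_all add: gsign_def)

instantiation gr :: real_algebra_1
begin

definition "0 = Gr (\<lambda>K. 0)"
definition "1 = Gr (\<lambda>K. if K = {} then 1 else 0)"
definition "a + b = Gr (\<lambda>K. coeff a K + coeff b K)"
definition "a - b = Gr (\<lambda>K. coeff a K - coeff b K)"
definition "- a = Gr (\<lambda>K. - coeff a K)"
definition "r *\<^sub>R a = Gr (\<lambda>K. r * coeff a K)"
definition "a * b = Gr (\<lambda>K. if finite K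
    then \<Sum>I\<in>Pow K. gsign I (K - I) * coeff a I * coeff b (K - I) else 0)"

lemma coeff_zero [simp]: "coeff 0 K = 0"
  and coeff_one: "coeff 1 K = (if K = {} then 1 else 0)"
  and coeff_add [simp]: "coeff (a + b) K = coeff a K + coeff b K"
  and coeff_diff [simp]: "coeff (a - b) K = coeff a K - coeff b K"
  and coeff_uminus [simp]: "coeff (- a) K = - coeff a K"
  and coeff_scaleR [simp]: "coeff (r *\<^sub>R a) K = r * coeff a K"
  unfolding zero_gr_def one_gr_def plus_gr_def minus_gr_def uminus_gr_def scaleR_gr_def
  by (subst coeff_Gr; force)+

lemma coeff_mult: "finite K \<Longrightarrow>
    coeff (a * b) K = (\<Sum>I\<in>Pow K. gsign I (K - I) * coeff a I * coeff b (K - I))"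
  by (simp add: times_gr_def coeff_Gr)

lemma gr_mult_assoc: "(a * b) * c = a * (b * (c::gr))"
proof (rule gr_eqI)
  fix K :: "nat set" assume K: "finite K"
  have fin: "finite X" if "X \<subseteq> K" for X using that K finite_subset by blast
  let ?P = "SIGMA H:Pow K. Pow H" and ?R = "SIGMA I:Pow K. Pow (K - I)"
  have "coeff ((a * b) * c) K = (\<Sum>H\<in>Pow K. \<Sum>I\<in>Pow H. gsign H (K - H) * gsign I (H - I) *
      coeff a I * coeff b (H - I) * coeff c (K - H))"
    using K by (auto simp: coeff_mult fin sum_distrib_left sum_distrib_right mult_ac intro!: sum.cong)
  also have "\<dots> = (\<Sum>(H, I)\<in>?P. gsign H (K - H) * gsign I (H - I) *
      coeff a I * coeff b (H - I) * coeff c (K - H))"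
    using K by (subst sum.Sigma) (auto simp: fin)
  also have "\<dots> = (\<Sum>(I, J)\<in>?R. gsign I (K - I) * gsign J (K - I - J) *
      coeff a I * coeff b J * coeff c (K - I - J))"
  proof (rule sum.reindex_bij_witness[of _ "\<lambda>(I, J). (I \<union> J, I)" "\<lambda>(H, I). (I, H - I)"])
    fix x assume "x \<in> ?P"
    then obtain H I where x: "x = (H, I)" "H \<subseteq> K" "I \<subseteq> H" by auto
    let ?J = "H - I" and ?L = "K - H"
    have f: "finite I" "finite ?J" "finite ?L" using x fin by auto
    have H: "I \<union> ?J = H" "?J \<union> ?L = K - I" "K - I - ?J = ?L" using x by auto
    have "gsign H ?L = gsign I ?L * gsign ?J ?L"
      using gsign_Un_left[of I ?J ?L] f H by auto
    moreover have "gsign I (K - I) = gsign I ?J * gsign I ?L"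
      using gsign_Un_right[of I ?J ?L] f H by auto
    ultimately show "(case case x of (H, I) \<Rightarrow> (I, H - I) of (I, J) \<Rightarrow> gsign I (K - I) *
        gsign J (K - I - J) * coeff a I * coeff b J * coeff c (K - I - J)) =
      (case x of (H, I) \<Rightarrow> gsign H (K - H) * gsign I (H - I) *
        coeff a I * coeff b (H - I) * coeff c (K - H))"
      using x H by (simp add: mult_ac)
  qed auto
  also have "\<dots> = (\<Sum>I\<in>Pow K. \<Sum>J\<in>Pow (K - I). gsign I (K - I) * gsign J (K - I - J) *
      coeff a I * coeff b J * coeff c (K - I - J))"
    using K by (subst sum.Sigma) (auto simp: fin)
  also have "\<dots> = coeff (a * (b * c)) K"
    using K by (auto simp: coeff_mult fin sum_distrib_left mult_ac intro!: sum.cong)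
  finally show "coeff ((a * b) * c) K = coeff (a * (b * c)) K" .
qed

lemma gr_one_mult: "1 * a = (a::gr)" "a * 1 = a"
proof -
  show "1 * a = a"
  proof (rule gr_eqI)
    fix K :: "nat set" assume K: "finite K"
    have "coeff (1 * a) K = (\<Sum>I\<in>Pow K. if I = {} then coeff a K else 0)"
      unfolding coeff_mult[OF K] by (rule sum.cong) (auto simp: coeff_one)
    then show "coeff (1 * a) K = coeff a K" using K by simp
  qed
  show "a * 1 = a"
  proof (rule gr_eqI)
    fix K :: "nat set" assume K: "finite K"
    have "coeff (a * 1) K = (\<Sum>I\<in>Pow K. if I = K then coeff a K else 0)"
      unfolding coeff_mult[OF K] by (rule sum.cong) (auto simp: coeff_one)
    then show "coeff (a * 1) K = coeff a K" using K by simp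
  qed
qed

instance
proof
  fix a b c :: gr and r s :: real
  show "(a * b) * c = a * (b * c)" by (rule gr_mult_assoc)
  show "1 * a = a" "a * 1 = a" by (rule gr_one_mult)+
  show "(a + b) * c = a * c + b * c" "a * (b + c) = a * b + a * c"
    by (rule gr_eqI, simp add: coeff_mult algebra_simps sum.distrib)+
  show "r *\<^sub>R a * b = r *\<^sub>R (a * b)" "a * r *\<^sub>R b = r *\<^sub>R (a * b)"
    by (rule gr_eqI, simp add: coeff_mult algebra_simps sum_distrib_left)+
  show "(0::gr) \<noteq> 1"
    by (metis coeff_one coeff_zero zero_neq_one)
qed (rule gr_eqI; simp add: algebra_simps)+

end

definition grass :: "nat \<Rightarrow> gr set" where
  "grass q = {a. \<forall>K. coeff a K \<noteq> 0 \<longrightarrow> K \<subseteq> {..<q}}"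

definition gen :: "nat \<Rightarrow> gr" where
  "gen k = Gr (\<lambda>K. if K = {k} then 1 else 0)"

text \<open>\<open>ginvol\<close> is the parity involution \<open>a \<mapsto> (-1)\<^bsup>|a|\<^esup> a\<close>.  Thus \<open>a\<close> is even iff
  \<open>ginvol a = a\<close> and odd iff \<open>ginvol a = - a\<close>.\<close>

definition ginvol :: "gr \<Rightarrow> gr" where
  "ginvol a = Gr (\<lambda>K. (- 1) ^ card K * coeff a K)"

text \<open>The left derivative \<open>\<partial>/\<partial>\<theta>\<^sub>b\<close>.\<close>

definition odd_pd :: "nat \<Rightarrow> gr \<Rightarrow> gr" where
  "odd_pd b a = Gr (\<lambda>K. if finite K \<and> b \<notin> K
     then (- 1) ^ card {k \<in> K. k < b} * coeff a (insert b K) else 0)"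


section \<open>Superdomains\<close>

text \<open>\<open>\<real>\<^sup>p\<close> is realised as the sequences vanishing from index \<open>p\<close> on, so that \<open>p\<close> is an ordinary
  natural number, possibly \<open>0\<close>.\<close>

type_synonym pt = "nat \<Rightarrow> real"

definition coord_space :: "nat \<Rightarrow> pt topology" where
  "coord_space p = subtopology euclidean {y. \<forall>i\<ge>p. y i = 0}"

definition pd :: "nat \<Rightarrow> (pt \<Rightarrow> real) \<Rightarrow> pt \<Rightarrow> real" where
  "pd i f y = deriv (\<lambda>t. f (y(i := t))) (y i)"

definition smooth :: "nat \<Rightarrow> pt set \<Rightarrow> (pt \<Rightarrow> real) \<Rightarrow> bool" where
  "smooth p V f \<longleftrightarrow> (\<forall>is \<in> lists {..<p}.
     continuous_on V (foldr pd is f) \<and>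
     (\<forall>i<p. \<forall>y\<in>V. (\<lambda>t. foldr pd is f (y(i := t))) field_differentiable at (y i)))"

text \<open>\<open>C\<^sup>\<infinity>(V) \<otimes> \<Lambda>\<^sub>q\<close>, for \<open>V\<close> open in \<open>\<real>\<^sup>p\<close>; functions are extended by zero outside of \<open>V\<close>.\<close>

definition sdom_fns :: "nat \<Rightarrow> nat \<Rightarrow> pt set \<Rightarrow> (pt \<Rightarrow> gr) set" where
  "sdom_fns p q V = {f. (\<forall>y. y \<notin> V \<longrightarrow> f y = 0) \<and> (\<forall>y. f y \<in> grass q) \<and>
     (\<forall>K. smooth p V (\<lambda>y. coeff (f y) K))}"

definition even_pd :: "nat \<Rightarrow> (pt \<Rightarrow> gr) \<Rightarrow> pt \<Rightarrow> gr" where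
  "even_pd i f y = Gr (\<lambda>K. pd i (\<lambda>y. coeff (f y) K) y)"


section \<open>Supermanifolds\<close>

text \<open>Real smooth supermanifolds in the sense of Berezin and Leites: a Hausdorff second countable
  space with a sheaf of superalgebras locally isomorphic to \<open>C\<^sup>\<infinity>(V) \<otimes> \<Lambda>\<^sub>q\<close>, \<open>V\<close> open in \<open>\<real>\<^sup>p\<close>.
  A countable atlas is part of the data (second countability follows from it), and a section of
  the structure sheaf is recorded as the family of its local expressions: \<open>F i x\<close> is the value in
  \<open>\<Lambda>\<^sub>q\<close> of the expression of \<open>F\<close> in the \<open>i\<close>-th chart at the point with coordinates
  \<open>coord X i x\<close> (and \<open>0\<close> if \<open>x\<close> is not in the domain of \<open>F\<close> or not in the chart).  The algebra operations are
  therefore pointwise.  How the expressions in different charts are related, i.e. the transition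
  isomorphisms, is encoded in the sets \<open>fns X U\<close> of sections over the open sets \<open>U\<close>.
  A supermanifold has at most continuum many points and every supermanifold has a countable
  atlas, so up to isomorphism every supermanifold occurs in the (monomorphic) type below; this makes it
  possible to quantify over all supermanifolds in universal properties.\<close>

type_synonym sec = "nat \<Rightarrow> pt \<Rightarrow> gr"

record supermfd =
  edim :: nat
  odim :: nat
  body :: "pt topology"
  cdom :: "nat \<Rightarrow> pt set"
  coord :: "nat \<Rightarrow> pt \<Rightarrow> pt"
  fns :: "pt set \<Rightarrow> sec set"

abbreviation points :: "supermfd \<Rightarrow> pt set" where
  "points X \<equiv> topspace (body X)"

definition restr :: "pt set \<Rightarrow> sec \<Rightarrow> sec" where
  "restr U F = (\<lambda>i x. if x \<in> U then F i x else 0)"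

definition const_sec :: "supermfd \<Rightarrow> pt set \<Rightarrow> real \<Rightarrow> sec" where
  "const_sec X U r = (\<lambda>i x. if x \<in> U \<inter> cdom X i then of_real r else 0)"

definition invol_sec :: "sec \<Rightarrow> sec" where
  "invol_sec F = (\<lambda>i x. ginvol (F i x))"

definition local_expr :: "supermfd \<Rightarrow> nat \<Rightarrow> pt set \<Rightarrow> sec \<Rightarrow> pt \<Rightarrow> gr" where
  "local_expr X i U F = (\<lambda>y. if y \<in> coord X i ` (U \<inter> cdom X i)
     then F i (inv_into (cdom X i) (coord X i) y) else 0)"

definition supermanifold :: "supermfd \<Rightarrow> bool" where
  "supermanifold X \<longleftrightarrow>
     Hausdorff_space (body X) \<and>
     (\<forall>i. openin (body X) (cdom X i)) \<and> (\<Union>i. cdom X i) = points X \<and>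
     (\<forall>i. openin (coord_space (edim X)) (coord X i ` cdom X i) \<and>
        homeomorphic_map (subtopology (body X) (cdom X i))
          (subtopology (coord_space (edim X)) (coord X i ` cdom X i)) (coord X i)) \<and>
     \<comment> \<open>sheaf of superalgebras\<close>
     (\<forall>U. openin (body X) U \<longrightarrow>
        (\<forall>F\<in>fns X U. \<forall>i x. x \<notin> U \<inter> cdom X i \<longrightarrow> F i x = 0) \<and>
        (\<forall>r. const_sec X U r \<in> fns X U) \<and>
        (\<forall>F\<in>fns X U. invol_sec F \<in> fns X U) \<and>
        (\<forall>F\<in>fns X U. \<forall>H\<in>fns X U.
           (\<lambda>i x. F i x + H i x) \<in> fns X U \<and> (\<lambda>i x. F i x * H i x) \<in> fns X U) \<and>
        (\<forall>V. openin (body X) V \<and> V \<subseteq> U \<longrightarrow> (\<forall>F\<in>fns X U. restr V F \<in> fns X V))) \<and>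
     (\<forall>\<U> F. (\<forall>U\<in>\<U>. openin (body X) U \<and> restr U F \<in> fns X U) \<and> restr (\<Union>\<U>) F = F
        \<longrightarrow> F \<in> fns X (\<Union>\<U>)) \<and>
     \<comment> \<open>isomorphic over each chart to a superdomain\<close>
     (\<forall>i U. openin (body X) U \<and> U \<subseteq> cdom X i \<longrightarrow>
        bij_betw (local_expr X i U) (fns X U) (sdom_fns (edim X) (odim X) (coord X i ` U))) \<and>
     \<comment> \<open>the numerical value of a function at a point does not depend on the chart\<close>
     (\<forall>U F i j x. openin (body X) U \<and> F \<in> fns X U \<and> x \<in> U \<inter> cdom X i \<inter> cdom X j \<longrightarrow>
        coeff (F i x) {} = coeff (F j x) {})"

definition value_at :: "supermfd \<Rightarrow> sec \<Rightarrow> pt \<Rightarrow> real" where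
  "value_at X F x = coeff (F (SOME i. x \<in> cdom X i) x) {}"

text \<open>Homotopical properties of a supermanifold are those of its underlying space.  The library's
  \<open>contractible_space\<close> admits the empty space.\<close>

definition contractible_supermfd :: "supermfd \<Rightarrow> bool" where
  "contractible_supermfd X \<longleftrightarrow> contractible_space (body X) \<and> points X \<noteq> {}"


section \<open>Morphisms\<close>

text \<open>Morphisms of ringed superspaces: a continuous map with a family of homomorphisms of superalgebras
  \<open>\<O>\<^sub>Y(V) \<rightarrow> \<O>\<^sub>X(\<phi>\<^sup>-\<^sup>1(V))\<close>.  They are normalised outside of the relevant domains so that equality
  of morphisms is HOL equality.\<close>

record mor =
  mmap :: "pt \<Rightarrow> pt"
  pull :: "pt set \<Rightarrow> sec \<Rightarrow> sec"

definition preim :: "supermfd \<Rightarrow> mor \<Rightarrow> pt set \<Rightarrow> pt set" where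
  "preim X \<phi> V = {x \<in> points X. mmap \<phi> x \<in> V}"

definition Mor :: "supermfd \<Rightarrow> supermfd \<Rightarrow> mor set" where
  "Mor X Y = {\<phi>.
     mmap \<phi> \<in> extensional (points X) \<and> continuous_map (body X) (body Y) (mmap \<phi>) \<and>
     (\<forall>V. \<not> openin (body Y) V \<longrightarrow> pull \<phi> V = (\<lambda>_. undefined)) \<and>
     (\<forall>V. openin (body Y) V \<longrightarrow>
        pull \<phi> V \<in> fns Y V \<rightarrow>\<^sub>E fns X (preim X \<phi> V) \<and>
        (\<forall>r. pull \<phi> V (const_sec Y V r) = const_sec X (preim X \<phi> V) r) \<and>
        (\<forall>F\<in>fns Y V. pull \<phi> V (invol_sec F) = invol_sec (pull \<phi> V F)) \<and>
        (\<forall>F\<in>fns Y V. \<forall>H\<in>fns Y V.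
           pull \<phi> V (\<lambda>i x. F i x + H i x) = (\<lambda>i x. pull \<phi> V F i x + pull \<phi> V H i x) \<and>
           pull \<phi> V (\<lambda>i x. F i x * H i x) = (\<lambda>i x. pull \<phi> V F i x * pull \<phi> V H i x)) \<and>
        (\<forall>W. openin (body Y) W \<and> W \<subseteq> V \<longrightarrow>
           (\<forall>F\<in>fns Y V. pull \<phi> W (restr W F) = restr (preim X \<phi> W) (pull \<phi> V F))) \<and>
        (\<forall>F\<in>fns Y V. \<forall>x\<in>preim X \<phi> V. value_at X (pull \<phi> V F) x = value_at Y F (mmap \<phi> x)))}"

text \<open>\<open>mcomp X Y Z \<psi> \<phi>\<close> is \<open>\<psi> \<circ> \<phi>\<close> for \<open>\<phi> : X \<rightarrow> Y\<close>, \<open>\<psi> : Y \<rightarrow> Z\<close>.\<close>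

definition mcomp :: "supermfd \<Rightarrow> supermfd \<Rightarrow> supermfd \<Rightarrow> mor \<Rightarrow> mor \<Rightarrow> mor" where
  "mcomp X Y Z \<psi> \<phi> = \<lparr>mmap = restrict (mmap \<psi> \<circ> mmap \<phi>) (points X),
     pull = (\<lambda>V. if openin (body Z) V
       then restrict (pull \<phi> (preim Y \<psi> V) \<circ> pull \<psi> V) (fns Z V) else (\<lambda>_. undefined))\<rparr>"

definition const_mor :: "supermfd \<Rightarrow> supermfd \<Rightarrow> pt \<Rightarrow> mor" where
  "const_mor X Y e = \<lparr>mmap = restrict (\<lambda>_. e) (points X),
     pull = (\<lambda>V. if openin (body Y) V
       then restrict (\<lambda>F. const_sec X (if e \<in> V then points X else {}) (value_at Y F e)) (fns Y V)
       else (\<lambda>_. undefined))\<rparr>"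

definition is_product :: "supermfd \<Rightarrow> supermfd \<Rightarrow> supermfd \<Rightarrow> mor \<Rightarrow> mor \<Rightarrow> bool" where
  "is_product X Y Q p1 p2 \<longleftrightarrow> supermanifold Q \<and> p1 \<in> Mor Q X \<and> p2 \<in> Mor Q Y \<and>
     (\<forall>S f h. supermanifold S \<and> f \<in> Mor S X \<and> h \<in> Mor S Y \<longrightarrow>
        (\<exists>!k. k \<in> Mor S Q \<and> mcomp S Q X p1 k = f \<and> mcomp S Q Y p2 k = h))"


section \<open>Vector fields\<close>

text \<open>Vector fields of parity \<open>k\<close> (\<open>0\<close> or \<open>1\<close>): derivations of parity \<open>k\<close> of the structure sheaf,
  acting from the left.  The sign \<open>(-1)\<^bsup>k|F|\<^esup> F\<close> is \<open>(invol_sec ^^ k) F\<close>.\<close>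

type_synonym vfield = "pt set \<Rightarrow> sec \<Rightarrow> sec"

definition vfields :: "supermfd \<Rightarrow> nat \<Rightarrow> vfield set" where
  "vfields X k = {D.
     (\<forall>U. \<not> openin (body X) U \<longrightarrow> D U = (\<lambda>_. undefined)) \<and>
     (\<forall>U. openin (body X) U \<longrightarrow>
        D U \<in> fns X U \<rightarrow>\<^sub>E fns X U \<and>
        (\<forall>r. D U (const_sec X U r) = (\<lambda>i x. 0)) \<and>
        (\<forall>F\<in>fns X U. D U (invol_sec F) = (\<lambda>i x. (- 1) ^ k * invol_sec (D U F) i x)) \<and>
        (\<forall>F\<in>fns X U. \<forall>H\<in>fns X U.
           D U (\<lambda>i x. F i x + H i x) = (\<lambda>i x. D U F i x + D U H i x) \<and>
           D U (\<lambda>i x. F i x * H i x) =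
             (\<lambda>i x. D U F i x * H i x + (invol_sec ^^ k) F i x * D U H i x)) \<and>
        (\<forall>W. openin (body X) W \<and> W \<subseteq> U \<longrightarrow>
           (\<forall>F\<in>fns X U. D W (restr W F) = restr W (D U F))))}"


section \<open>The antitangent bundle and differential forms\<close>

text \<open>\<open>is_PiT M P \<pi>\<close>: \<open>P\<close> with projection \<open>\<pi>\<close> is \<open>\<Pi>TM\<close>, with its induced atlas.  If \<open>M\<close> has local coordinates
  \<open>x\<^sup>a\<close> (even, \<open>a < p\<close>) and \<open>\<xi>\<^sup>b\<close> (odd, \<open>b < q\<close>), then \<open>\<Pi>TM\<close> has the even coordinates
  \<open>x\<^sup>a\<close> (index \<open>a\<close>) and \<open>d\<xi>\<^sup>b\<close> (index \<open>p + b\<close>, arbitrary real values, whence pseudodifferential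
  forms) and the odd coordinates \<open>\<xi>\<^sup>b\<close> (index \<open>b\<close>) and \<open>dx\<^sup>a\<close> (index \<open>q + a\<close>).
  In each chart \<open>\<pi>\<close> forgets the fibre coordinates, and \<open>d\<close> is the odd vector field \<open>dx\<^sup>a \<partial>/\<partial>x\<^sup>a + d\<xi>\<^sup>b \<partial>/\<partial>\<xi>\<^sup>b\<close>.
  That these expressions in the various charts define sections of the structure sheaf of \<open>P\<close>
  says that the fibre coordinates transform by \<open>dx'\<^sup>a = d(x'\<^sup>a)\<close>, \<open>d\<xi>'\<^sup>b = d(\<xi>'\<^sup>b)\<close>.\<close>

definition d_local :: "nat \<Rightarrow> nat \<Rightarrow> (pt \<Rightarrow> gr) \<Rightarrow> pt \<Rightarrow> gr" where
  "d_local p q f y = (\<Sum>a<p. gen (q + a) * even_pd a f y) + (\<Sum>b<q. y (p + b) *\<^sub>R odd_pd b (f y))"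

definition ext_d :: "supermfd \<Rightarrow> supermfd \<Rightarrow> vfield" where
  "ext_d M P U = (if openin (body P) U then restrict (\<lambda>F i z. if z \<in> U \<inter> cdom P i
       then d_local (edim M) (odim M) (local_expr P i U F) (coord P i z) else 0) (fns P U)
     else (\<lambda>_. undefined))"

definition is_PiT :: "supermfd \<Rightarrow> supermfd \<Rightarrow> mor \<Rightarrow> bool" where
  "is_PiT M P \<pi> \<longleftrightarrow> supermanifold P \<and> \<pi> \<in> Mor P M \<and>
     edim P = edim M + odim M \<and> odim P = odim M + edim M \<and>
     (\<forall>i. cdom P i = preim P \<pi> (cdom M i) \<and>
        (\<forall>z\<in>cdom P i. \<forall>a<edim M. coord P i z a = coord M i (mmap \<pi> z) a) \<and>
        coord P i ` cdom P i = {y \<in> topspace (coord_space (edim P)).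
          (\<lambda>a. if a < edim M then y a else 0) \<in> coord M i ` cdom M i}) \<and>
     (\<forall>V F i z. openin (body M) V \<and> F \<in> fns M V \<and> z \<in> preim P \<pi> V \<inter> cdom P i \<longrightarrow>
        pull \<pi> V F i z = F i (mmap \<pi> z)) \<and>
     ext_d M P \<in> vfields P 1"


section \<open>Lie supergroups\<close>

text \<open>Group objects in the category of supermanifolds; \<open>gsq\<close> with \<open>gpr1\<close>, \<open>gpr2\<close> is the product
  of the group with itself.  The group axioms are expressed on \<open>S\<close>-points, for all \<open>S\<close>.\<close>

record lie_sgroup =
  gmfd :: supermfd
  gsq :: supermfd
  gpr1 :: mor
  gpr2 :: mor
  gmult :: mor
  ginv :: mor
  gunit :: pt

definition pair_mor :: "lie_sgroup \<Rightarrow> supermfd \<Rightarrow> mor \<Rightarrow> mor \<Rightarrow> mor" where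
  "pair_mor G S f h = (THE k. k \<in> Mor S (gsq G) \<and>
     mcomp S (gsq G) (gmfd G) (gpr1 G) k = f \<and> mcomp S (gsq G) (gmfd G) (gpr2 G) k = h)"

text \<open>The group structure on the set \<open>Mor S (gmfd G)\<close> of \<open>S\<close>-points.\<close>

definition pmult :: "lie_sgroup \<Rightarrow> supermfd \<Rightarrow> mor \<Rightarrow> mor \<Rightarrow> mor" where
  "pmult G S f h = mcomp S (gsq G) (gmfd G) (gmult G) (pair_mor G S f h)"

definition pinv :: "lie_sgroup \<Rightarrow> supermfd \<Rightarrow> mor \<Rightarrow> mor" where
  "pinv G S f = mcomp S (gmfd G) (gmfd G) (ginv G) f"

definition pone :: "lie_sgroup \<Rightarrow> supermfd \<Rightarrow> mor" where
  "pone G S = const_mor S (gmfd G) (gunit G)"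

definition lie_supergroup :: "lie_sgroup \<Rightarrow> bool" where
  "lie_supergroup G \<longleftrightarrow> supermanifold (gmfd G) \<and>
     is_product (gmfd G) (gmfd G) (gsq G) (gpr1 G) (gpr2 G) \<and>
     gmult G \<in> Mor (gsq G) (gmfd G) \<and> ginv G \<in> Mor (gmfd G) (gmfd G) \<and>
     gunit G \<in> points (gmfd G) \<and>
     (\<forall>S f h k. supermanifold S \<and> f \<in> Mor S (gmfd G) \<and> h \<in> Mor S (gmfd G) \<and> k \<in> Mor S (gmfd G) \<longrightarrow>
        pmult G S (pmult G S f h) k = pmult G S f (pmult G S h k) \<and>
        pmult G S (pone G S) f = f \<and> pmult G S f (pone G S) = f \<and>
        pmult G S (pinv G S f) f = pone G S \<and> pmult G S f (pinv G S f) = pone G S)"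


section \<open>Lie superalgebras\<close>

record 'g lsa =
  geven :: "'g set"
  godd :: "'g set"
  brk :: "'g \<Rightarrow> 'g \<Rightarrow> 'g"

definition gpart :: "('g, 'm) lsa_scheme \<Rightarrow> nat \<Rightarrow> 'g set" where
  "gpart L k = (if even k then geven L else godd L)"

definition lie_superalgebra :: "'g::real_vector lsa \<Rightarrow> bool" where
  "lie_superalgebra L \<longleftrightarrow>
     subspace (geven L) \<and> subspace (godd L) \<and> geven L \<inter> godd L = {0} \<and>
     (\<forall>x. \<exists>a\<in>geven L. \<exists>b\<in>godd L. x = a + b) \<and>
     bilinear (brk L) \<and>
     (\<forall>j k. \<forall>x\<in>gpart L j. \<forall>y\<in>gpart L k.
        brk L x y \<in> gpart L (j + k) \<and>
        brk L x y = - ((- 1) ^ (j * k) *\<^sub>R brk L y x) \<and>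
        (\<forall>z. brk L x (brk L y z) = brk L (brk L x y) z + (- 1) ^ (j * k) *\<^sub>R brk L y (brk L x z)))"

definition lsa_square :: "'g::real_vector lsa \<Rightarrow> 'g \<Rightarrow> 'g" where
  "lsa_square L x = (1 / 2) *\<^sub>R brk L x x"

definition homological :: "'g::real_vector lsa \<Rightarrow> 'g \<Rightarrow> bool" where
  "homological L x \<longleftrightarrow> x \<in> godd L \<and> brk L x x = 0"

text \<open>A vector field \<open>D\<close> on \<open>G\<close> is left invariant if \<open>\<mu>\<^sup>* \<circ> D = (1 \<otimes> D) \<circ> \<mu>\<^sup>*\<close>, where \<open>\<mu>\<close> is the
  multiplication and \<open>1 \<otimes> D\<close> is the vector field on \<open>G \<times> G\<close> (called \<open>E\<close> below) which annihilates
  functions of the first factor and acts as \<open>D\<close> on functions of the second.\<close>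

definition left_invariant :: "lie_sgroup \<Rightarrow> nat \<Rightarrow> vfield set" where
  "left_invariant G k = {D \<in> vfields (gmfd G) k. \<exists>E \<in> vfields (gsq G) k.
     \<forall>V F. openin (body (gmfd G)) V \<and> F \<in> fns (gmfd G) V \<longrightarrow>
       E (preim (gsq G) (gpr1 G) V) (pull (gpr1 G) V F) = (\<lambda>i x. 0) \<and>
       E (preim (gsq G) (gpr2 G) V) (pull (gpr2 G) V F) = pull (gpr2 G) V (D V F) \<and>
       E (preim (gsq G) (gmult G) V) (pull (gmult G) V F) = pull (gmult G) V (D V F)}"

text \<open>\<open>lam\<close> identifies the Lie superalgebra \<open>L\<close> with that of \<open>G\<close>, i.e. with the left-invariant vector
  fields under the supercommutator.\<close>

definition lie_algebra_of :: "lie_sgroup \<Rightarrow> 'g::real_vector lsa \<Rightarrow> ('g \<Rightarrow> vfield) \<Rightarrow> bool" where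
  "lie_algebra_of G L lam \<longleftrightarrow>
     (\<forall>k\<in>{0, 1}. bij_betw lam (gpart L k) (left_invariant G k)) \<and>
     (\<forall>V F. openin (body (gmfd G)) V \<and> F \<in> fns (gmfd G) V \<longrightarrow>
        (\<forall>x y. lam (x + y) V F = (\<lambda>i z. lam x V F i z + lam y V F i z)) \<and>
        (\<forall>r x. lam (r *\<^sub>R x) V F = (\<lambda>i z. r *\<^sub>R lam x V F i z)) \<and>
        (\<forall>j\<in>{0, 1}. \<forall>k\<in>{0, 1}. \<forall>x\<in>gpart L j. \<forall>y\<in>gpart L k.
           lam (brk L x y) V F =
             (\<lambda>i z. lam x V (lam y V F) i z - (- 1) ^ (j * k) *\<^sub>R lam y V (lam x V F) i z)))"


section \<open>Forms with values in a Lie superalgebra\<close>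

text \<open>The Lie superalgebra is assumed finite-dimensional.  An element \<open>\<Sum>\<^sub>b \<sigma>\<^sup>b \<otimes> b\<close> of \<open>\<O>(P) \<otimes> \<gg>\<close>, the sum
  being over a homogeneous basis \<open>B\<close>, is represented by the family \<open>\<sigma>\<close> of its coefficients.\<close>

type_synonym 'g gform = "'g \<Rightarrow> sec"

definition homogeneous_basis :: "'g::real_vector lsa \<Rightarrow> 'g set \<Rightarrow> bool" where
  "homogeneous_basis L B \<longleftrightarrow>
     finite B \<and> independent B \<and> span B = UNIV \<and> B \<subseteq> geven L \<union> godd L"

definition par :: "'g::real_vector lsa \<Rightarrow> 'g \<Rightarrow> nat" where
  "par L b = (if b \<in> godd L then 1 else 0)"

text \<open>Odd total parity: \<open>\<sigma>\<^sup>b\<close> has parity \<open>1 + |b|\<close>.\<close>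

definition odd_gforms :: "supermfd \<Rightarrow> 'g::real_vector lsa \<Rightarrow> 'g set \<Rightarrow> 'g gform set" where
  "odd_gforms P L B = {\<sigma>. (\<forall>b. b \<notin> B \<longrightarrow> \<sigma> b = (\<lambda>i z. 0)) \<and>
     (\<forall>b\<in>B. \<sigma> b \<in> fns P (points P) \<and>
        invol_sec (\<sigma> b) = (\<lambda>i z. (- 1) ^ (1 + par L b) * \<sigma> b i z))}"

definition const_gform :: "supermfd \<Rightarrow> 'g::real_vector set \<Rightarrow> 'g \<Rightarrow> 'g gform" where
  "const_gform P B c = (\<lambda>b. const_sec P (points P) (representation B c b))"

definition d_gform :: "supermfd \<Rightarrow> supermfd \<Rightarrow> 'g::real_vector set \<Rightarrow> 'g gform \<Rightarrow> 'g gform" where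
  "d_gform M P B \<sigma> = (\<lambda>b. if b \<in> B then ext_d M P (points P) (\<sigma> b) else (\<lambda>i z. 0))"

text \<open>\<open>[\<sigma>\<^sup>a \<otimes> a, \<tau>\<^sup>b \<otimes> b] = (-1)\<^bsup>|a||\<tau>\<^sup>b|\<^esup> \<sigma>\<^sup>a \<tau>\<^sup>b \<otimes> [a, b]\<close>.\<close>

definition brk_gform :: "'g::real_vector lsa \<Rightarrow> 'g set \<Rightarrow> 'g gform \<Rightarrow> 'g gform \<Rightarrow> 'g gform" where
  "brk_gform L B \<sigma> \<tau> = (\<lambda>c i z. \<Sum>a\<in>B. \<Sum>b\<in>B. representation B (brk L a b) c *\<^sub>R
     (\<sigma> a i z * (invol_sec ^^ par L a) (\<tau> b) i z))"

definition sq_gform :: "'g::real_vector lsa \<Rightarrow> 'g set \<Rightarrow> 'g gform \<Rightarrow> 'g gform" where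
  "sq_gform L B \<sigma> = (\<lambda>c i z. (1 / 2) *\<^sub>R brk_gform L B \<sigma> \<sigma> c i z)"

definition maurer_cartan ::
    "supermfd \<Rightarrow> supermfd \<Rightarrow> 'g::real_vector lsa \<Rightarrow> 'g set \<Rightarrow> 'g gform \<Rightarrow> bool" where
  "maurer_cartan M P L B \<omega> \<longleftrightarrow>
     (\<forall>b i z. d_gform M P B \<omega> b i z + sq_gform L B \<omega> b i z = 0)"


section \<open>Adjoint action and logarithmic derivative\<close>

text \<open>\<open>X \<times> \<real>\<^bsup>0|1\<^esup>\<close>; its sections are \<open>F0 + \<epsilon> F1\<close>, where \<open>\<epsilon>\<close> is the new odd coordinate, of
  index \<open>odim X\<close>.\<close>

definition times_R01 :: "supermfd \<Rightarrow> supermfd" where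
  "times_R01 X = X\<lparr>odim := Suc (odim X),
     fns := \<lambda>U. {(\<lambda>i x. F0 i x + gen (odim X) * F1 i x) | F0 F1. F0 \<in> fns X U \<and> F1 \<in> fns X U}\<rparr>"

definition pr_R01 :: "supermfd \<Rightarrow> mor" where
  "pr_R01 X = \<lparr>mmap = restrict id (points X),
     pull = (\<lambda>V. if openin (body X) V then restrict id (fns X V) else (\<lambda>_. undefined))\<rparr>"

text \<open>The map \<open>X \<times> \<real>\<^bsup>0|1\<^esup> \<rightarrow> X\<close>, \<open>F \<mapsto> F + \<epsilon> D F\<close>, of an odd vector field \<open>D\<close>.\<close>

definition odd_shift :: "supermfd \<Rightarrow> vfield \<Rightarrow> mor" where
  "odd_shift X D = \<lparr>mmap = restrict id (points X),
     pull = (\<lambda>V. if openin (body X) V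
       then restrict (\<lambda>F i x. F i x + gen (odim X) * D V F i x) (fns X V) else (\<lambda>_. undefined))\<rparr>"

text \<open>For an odd \<open>\<gg>\<close>-valued form \<open>\<sigma>\<close> the element \<open>\<epsilon>\<sigma>\<close> is even, and \<open>1 + \<epsilon>\<sigma>\<close> is an element of
  \<open>G\<close> infinitely close to the unit, i.e. a map \<open>P \<times> \<real>\<^bsup>0|1\<^esup> \<rightarrow> G\<close>:
  it takes \<open>F\<close> to \<open>F(e) + \<epsilon> \<Sum>\<^sub>b \<sigma>\<^sup>b (b F)(e)\<close>, where \<open>b \<in> \<gg>\<close> acts as a tangent vector at \<open>e\<close>.\<close>

definition one_plus_eps ::
    "lie_sgroup \<Rightarrow> ('g::real_vector \<Rightarrow> vfield) \<Rightarrow> 'g set \<Rightarrow> supermfd \<Rightarrow> 'g gform \<Rightarrow> mor" where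
  "one_plus_eps G lam B P \<sigma> = \<lparr>mmap = restrict (\<lambda>_. gunit G) (points P),
     pull = (\<lambda>V. if openin (body (gmfd G)) V
       then restrict (\<lambda>F i z. if gunit G \<in> V \<and> z \<in> cdom P i
           then of_real (value_at (gmfd G) F (gunit G)) +
             gen (odim P) * (\<Sum>b\<in>B. value_at (gmfd G) (lam b V F) (gunit G) *\<^sub>R \<sigma> b i z)
           else 0) (fns (gmfd G) V)
       else (\<lambda>_. undefined))\<rparr>"

text \<open>\<open>\<tau> = Ad(g) \<sigma>\<close> for odd \<open>\<sigma>\<close>: the differential of conjugation by \<open>g\<close>, that is,
  \<open>g (1 + \<epsilon>\<sigma>) g\<^sup>-\<^sup>1 = 1 + \<epsilon>\<tau>\<close>.\<close>

definition has_Ad :: "lie_sgroup \<Rightarrow> 'g::real_vector lsa \<Rightarrow> ('g \<Rightarrow> vfield) \<Rightarrow> 'g set \<Rightarrow> supermfd \<Rightarrow>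
    mor \<Rightarrow> 'g gform \<Rightarrow> 'g gform \<Rightarrow> bool" where
  "has_Ad G L lam B P g \<sigma> \<tau> \<longleftrightarrow> \<sigma> \<in> odd_gforms P L B \<and> \<tau> \<in> odd_gforms P L B \<and>
     (let S = times_R01 P; g' = mcomp S P (gmfd G) g (pr_R01 P) in
       pmult G S (pmult G S g' (one_plus_eps G lam B P \<sigma>)) (pinv G S g') = one_plus_eps G lam B P \<tau>)"

text \<open>\<open>\<theta> = dg g\<^sup>-\<^sup>1\<close>: the tangent vector \<open>g + \<epsilon> dg : F \<mapsto> g\<^sup>* F + \<epsilon> d (g\<^sup>* F)\<close> is brought to the unit by right
  translation, that is, \<open>(g + \<epsilon> dg) g\<^sup>-\<^sup>1 = 1 + \<epsilon>\<theta>\<close>.\<close>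

definition has_right_logderiv :: "lie_sgroup \<Rightarrow> 'g::real_vector lsa \<Rightarrow> ('g \<Rightarrow> vfield) \<Rightarrow> 'g set \<Rightarrow>
    supermfd \<Rightarrow> supermfd \<Rightarrow> mor \<Rightarrow> 'g gform \<Rightarrow> bool" where
  "has_right_logderiv G L lam B M P g \<theta> \<longleftrightarrow> \<theta> \<in> odd_gforms P L B \<and>
     (let S = times_R01 P; g' = mcomp S P (gmfd G) g (pr_R01 P);
          g_dg = mcomp S P (gmfd G) g (odd_shift P (ext_d M P)) in
       pmult G S g_dg (pinv G S g') = one_plus_eps G lam B P \<theta>)"

end

theory Submission
  imports Defs
begin

text \<open>The odd vector field \<open>d\<close> on \<open>\<Pi>TM\<close> vanishes at a point \<open>z\<close> of the body where all fibre coordinates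
  \<open>d\<xi>\<^sup>b\<close> are zero.  Evaluated at \<open>z\<close>, the form \<open>dg g\<^sup>-\<^sup>1\<close> is therefore \<open>0\<close> and \<open>\<omega>\<close> becomes the odd element
  \<open>w = Ad(h) C\<close> of \<open>\<gg>\<close>, where \<open>h\<close> is the value of \<open>g\<close> at \<open>z\<close>, while the Maurer-Cartan equation becomes
  \<open>[w, w] = 0\<close>.  The relation between \<open>w\<close> and \<open>C\<close> reads \<open>(1 + \<epsilon>w) h = h (1 + \<epsilon>C)\<close>.  Since right
  multiplication by \<open>1 + \<epsilon>x\<close> acts on functions as \<open>1 + \<epsilon>D\<^sub>x\<close>, with \<open>D\<^sub>x\<close> the left-invariant field of \<open>x\<close>, right
  translation by \<open>h\<close> intertwines \<open>D\<^sub>C\<close> and \<open>D\<^sub>w\<close>.  Hence \<open>D\<^sub>w\<^sup>2 = 0\<close> implies \<open>D\<^sub>C\<^sup>2 = 0\<close>, that is, \<open>[C, C] = 0\<close>.\<close>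

section \<open>Grassmann algebra\<close>

lemma coeff_of_real: "coeff (of_real r) K = (if K = {} then r else 0)"
  by (simp add: of_real_def coeff_one)

lemma coeff_sum: "coeff (sum f A) K = (\<Sum>x\<in>A. coeff (f x) K)"
  by (induction A rule: infinite_finite_induct) auto

lemma coeff_gen: "coeff (gen n) K = (if K = {n} then 1 else 0)"
  unfolding gen_def by (subst coeff_Gr) auto

lemma coeff_ginvol: "coeff (ginvol a) K = (- 1) ^ card K * coeff a K"
  unfolding ginvol_def by (subst coeff_Gr) auto

lemma coeff_odd_pd: "coeff (odd_pd n a) K =
    (if finite K \<and> n \<notin> K then (- 1) ^ card {k \<in> K. k < n} * coeff a (insert n K) else 0)"
  unfolding odd_pd_def by (subst coeff_Gr) auto

lemma gsign_sing_left: "gsign {n} J = (- 1) ^ card {k \<in> J. k < n}"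
proof -
  have "{(i, j). i \<in> {n} \<and> j \<in> J \<and> j < i} = Pair n ` {k \<in> J. k < n}" by auto
  then show ?thesis by (simp add: gsign_def card_image inj_on_def)
qed

lemma gsign_sing_right: "gsign J {n} = (- 1) ^ card {k \<in> J. n < k}"
proof -
  have "{(i, j). i \<in> J \<and> j \<in> {n} \<and> j < i} = (\<lambda>k. (k, n)) ` {k \<in> J. n < k}" by auto
  then show ?thesis by (simp add: gsign_def card_image inj_on_def)
qed

lemma coeff_gen_mult:
  assumes K: "finite K"
  shows "coeff (gen n * a) K =
    (if n \<in> K then (- 1) ^ card {k \<in> K. k < n} * coeff a (K - {n}) else 0)"
proof -
  have "coeff (gen n * a) K =
      (\<Sum>I\<in>Pow K. if I = {n} then gsign {n} (K - {n}) * coeff a (K - {n}) else 0)"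
    unfolding coeff_mult[OF K] by (rule sum.cong) (auto simp: coeff_gen)
  moreover have "{k \<in> K - {n}. k < n} = {k \<in> K. k < n}" by auto
  ultimately show ?thesis using K by (simp add: gsign_sing_left)
qed

lemma coeff_mult_gen:
  assumes K: "finite K"
  shows "coeff (a * gen n) K =
    (if n \<in> K then (- 1) ^ card {k \<in> K. n < k} * coeff a (K - {n}) else 0)"
proof -
  have "coeff (a * gen n) K = (\<Sum>I\<in>Pow K. if I = K - {n} then
      (if n \<in> K then gsign (K - {n}) {n} * coeff a (K - {n}) else 0) else 0)"
    unfolding coeff_mult[OF K] by (rule sum.cong) (auto simp: coeff_gen double_diff)
  moreover have "{k \<in> K - {n}. n < k} = {k \<in> K. n < k}" by auto
  ultimately show ?thesis using K by (simp add: gsign_sing_right)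
qed

lemma mult_gen_commute: "a * gen n = gen n * ginvol a"
proof (rule gr_eqI)
  fix K :: "nat set" assume K: "finite K"
  have "card (K - {n}) = card {k \<in> K. k < n} + card {k \<in> K. n < k}"
    using K by (subst card_Un_disjoint [symmetric]) (auto intro: arg_cong[where f = card])
  then have "(- 1) ^ card {k \<in> K. k < n} * (- 1) ^ card (K - {n}) = ((- 1) ^ card {k \<in> K. n < k} :: real)"
    by (simp add: power_add flip: mult.assoc power_mult_distrib)
  then show "coeff (a * gen n) K = coeff (gen n * ginvol a) K"
    unfolding coeff_gen_mult[OF K] coeff_mult_gen[OF K] coeff_ginvol mult.assoc[symmetric] by presburger
qed

lemma gen_mult_self: "gen n * gen n = 0"
  by (rule gr_eqI) (auto simp: coeff_gen_mult coeff_gen)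

lemma gen_gen_mult [simp]: "gen n * (gen n * a) = 0"
  by (simp add: gen_mult_self flip: mult.assoc)

lemma gen_mult_gen_mult [simp]: "gen n * a * (gen n * b) = 0"
proof -
  have "gen n * a * (gen n * b) = gen n * (a * gen n) * b" by (simp add: mult.assoc)
  then show ?thesis by (simp add: mult_gen_commute)
qed

lemma ginvol_zero [simp]: "ginvol 0 = 0"
  and ginvol_add [simp]: "ginvol (a + b) = ginvol a + ginvol b"
  and ginvol_uminus [simp]: "ginvol (- a) = - ginvol a"
  and ginvol_ginvol [simp]: "ginvol (ginvol a) = a"
  and ginvol_of_real [simp]: "ginvol (of_real r) = of_real r"
  and ginvol_gen [simp]: "ginvol (gen n) = - gen n"
  by (rule gr_eqI; simp add: coeff_ginvol coeff_of_real coeff_gen algebra_simps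
      flip: power_mult_distrib mult.assoc)+

lemma ginvol_mult [simp]: "ginvol (a * b) = ginvol a * ginvol b"
proof (rule gr_eqI)
  fix K :: "nat set" assume K: "finite K"
  have "card K = card I + card (K - I)" if "I \<subseteq> K" for I
    using K that by (metis card_Diff_subset card_mono finite_subset le_add_diff_inverse)
  then show "coeff (ginvol (a * b)) K = coeff (ginvol a * ginvol b) K"
    using K by (auto simp: coeff_mult coeff_ginvol sum_distrib_left power_add intro!: sum.cong)
qed

lemma gen_dual_mult:
  "(a + gen n * b) * (c + gen n * d) = a * c + gen n * (b * c + ginvol a * d)"
proof -
  have "a * (gen n * d) = gen n * (ginvol a * d)"
    by (simp add: mult_gen_commute flip: mult.assoc)
  then show ?thesis
    by (simp only: distrib_left distrib_right gen_mult_gen_mult) (simp add: mult.assoc)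
qed

lemma coeff_mult_empty: "coeff (a * b) {} = coeff a {} * coeff b {}"
  by (simp add: coeff_mult)

lemma coeff_mult_sing: "coeff (a * b) {n} = coeff a {} * coeff b {n} + coeff a {n} * coeff b {}"
  by (simp add: coeff_mult Pow_insert)

lemma coeff_gen_mult_empty [simp]: "coeff (gen n * a) {} = 0"
  by (simp add: coeff_gen_mult)

lemma coeff_gen_mult_sing [simp]: "coeff (gen n * a) {n} = coeff a {}"
  by (simp add: coeff_mult_sing coeff_gen)

lemma coeff_ginvol_empty [simp]: "coeff (ginvol a) {} = coeff a {}"
  by (simp add: coeff_ginvol)

lemma coeff_grass: "a \<in> grass n \<Longrightarrow> \<not> K \<subseteq> {..<n} \<Longrightarrow> coeff a K = 0"
  by (auto simp: grass_def)

lemma odd_pd_add: "odd_pd n (a + b) = odd_pd n a + odd_pd n b"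
  and odd_pd_zero [simp]: "odd_pd n 0 = 0"
  by (rule gr_eqI; simp add: coeff_odd_pd algebra_simps)+

lemma odd_pd_grass: "a \<in> grass n \<Longrightarrow> odd_pd n a = 0"
  by (rule gr_eqI) (auto simp: coeff_odd_pd coeff_grass)

lemma coeff_odd_pd_gen_mult: "finite K \<Longrightarrow>
    coeff (odd_pd n (gen n * a)) K = (if n \<in> K then 0 else coeff a K)"
proof (cases "n \<in> K")
  case False
  then have "{k \<in> insert n K. k < n} = {k \<in> K. k < n}" by auto
  moreover assume "finite K"
  ultimately show ?thesis using False
    by (simp add: coeff_odd_pd coeff_gen_mult flip: power_mult_distrib mult.assoc)
qed (simp add: coeff_odd_pd)

lemma odd_pd_gen_mult_grass: "a \<in> grass n \<Longrightarrow> odd_pd n (gen n * a) = a"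
  by (rule gr_eqI) (auto simp: coeff_odd_pd_gen_mult grass_def)

lemma gen_decomp: "odd_pd n (gen n * a) + gen n * odd_pd n a = a"
proof (rule gr_eqI)
  fix K :: "nat set" assume K: "finite K"
  have "{k \<in> K - {n}. k < n} = {k \<in> K. k < n}" by auto
  then show "coeff (odd_pd n (gen n * a) + gen n * odd_pd n a) K = coeff a K"
    using K by (simp add: coeff_odd_pd_gen_mult)
      (simp add: coeff_gen_mult coeff_odd_pd insert_absorb flip: power_mult_distrib mult.assoc)
qed

lemma gen_components:
  assumes "a \<in> grass n" "b \<in> grass n"
  shows "odd_pd n (gen n * (a + gen n * b)) = a" "odd_pd n (a + gen n * b) = b"
  using assms by (simp_all add: distrib_left odd_pd_gen_mult_grass odd_pd_add odd_pd_grass)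

lemma gen_decomp_eq:
  assumes "a + gen n * b = a' + gen n * b'" and "a \<in> grass n" "b \<in> grass n" "a' \<in> grass n" "b' \<in> grass n"
  shows "a = a'" "b = b'"
  using gen_components[OF assms(2,3)] gen_components[OF assms(4,5)] assms(1) by simp_all

lemma ginvol_odd_pd_grass:
  assumes "a \<in> grass (Suc n)"
  shows "coeff (ginvol (odd_pd n a)) K = (if n \<in> K then 0 else coeff a (insert n K))"
proof (cases "finite K \<and> n \<notin> K \<and> K \<subseteq> {..<n}")
  case True
  then have "{k \<in> K. k < n} = K" by auto
  with True show ?thesis
    by (simp add: coeff_odd_pd coeff_ginvol flip: power_mult_distrib mult.assoc)
next
  case False
  then have "n \<in> K \<or> infinite (insert n K) \<or> \<not> insert n K \<subseteq> {..<Suc n}"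
    by (auto simp: lessThan_Suc)
  then have "n \<in> K \<or> coeff a (insert n K) = 0"
    by (elim disjE) (simp_all add: coeff_grass[OF assms])
  then show ?thesis by (auto simp: coeff_odd_pd coeff_ginvol)
qed

section \<open>Supermanifolds\<close>

lemma const_sec_zero: "const_sec X U 0 = (\<lambda>i x. 0)"
  by (simp add: const_sec_def fun_eq_iff)

context
  fixes X :: supermfd
  assumes X: "supermanifold X"
begin

lemma sm_open_cdom: "openin (body X) (cdom X i)"
  using X by (simp add: supermanifold_def)

lemma sm_points: "points X = (\<Union>i. cdom X i)"
  using X by (simp add: supermanifold_def)

lemma sm_inj: "inj_on (coord X i) (cdom X i)"
proof -
  have "homeomorphic_map (subtopology (body X) (cdom X i))
      (subtopology (coord_space (edim X)) (coord X i ` cdom X i)) (coord X i)"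
    using X by (simp add: supermanifold_def)
  then show ?thesis
    using openin_subset[OF sm_open_cdom[of i]]
    by (metis homeomorphic_imp_injective_map topspace_subtopology_subset)
qed

lemma sm_algebra:
  "\<forall>U. openin (body X) U \<longrightarrow>
     (\<forall>F\<in>fns X U. \<forall>i x. x \<notin> U \<inter> cdom X i \<longrightarrow> F i x = 0) \<and>
     (\<forall>r. const_sec X U r \<in> fns X U) \<and>
     (\<forall>F\<in>fns X U. invol_sec F \<in> fns X U) \<and>
     (\<forall>F\<in>fns X U. \<forall>H\<in>fns X U.
        (\<lambda>i x. F i x + H i x) \<in> fns X U \<and> (\<lambda>i x. F i x * H i x) \<in> fns X U) \<and>
     (\<forall>V. openin (body X) V \<and> V \<subseteq> U \<longrightarrow> (\<forall>F\<in>fns X U. restr V F \<in> fns X V))"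
  by (insert X[unfolded supermanifold_def], elim conjE, assumption)

lemma sm_gluing:
  "\<forall>\<U> F. (\<forall>U\<in>\<U>. openin (body X) U \<and> restr U F \<in> fns X U) \<and> restr (\<Union>\<U>) F = F
     \<longrightarrow> F \<in> fns X (\<Union>\<U>)"
  by (insert X[unfolded supermanifold_def], elim conjE, assumption)

lemma sm_charts:
  "\<forall>i U. openin (body X) U \<and> U \<subseteq> cdom X i \<longrightarrow>
     bij_betw (local_expr X i U) (fns X U) (sdom_fns (edim X) (odim X) (coord X i ` U))"
  by (insert X[unfolded supermanifold_def], elim conjE, assumption)

lemma sm_values:
  "\<forall>U F i j x. openin (body X) U \<and> F \<in> fns X U \<and> x \<in> U \<inter> cdom X i \<inter> cdom X j \<longrightarrow>
     coeff (F i x) {} = coeff (F j x) {}"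
  by (insert X[unfolded supermanifold_def], elim conjE, assumption)

context
  fixes U assumes U: "openin (body X) U"
begin

lemma sm_outside: "F \<in> fns X U \<Longrightarrow> x \<notin> U \<inter> cdom X i \<Longrightarrow> F i x = 0"
  and sm_const: "const_sec X U r \<in> fns X U"
  and sm_invol: "F \<in> fns X U \<Longrightarrow> invol_sec F \<in> fns X U"
  and sm_add: "F \<in> fns X U \<Longrightarrow> H \<in> fns X U \<Longrightarrow> (\<lambda>i x. F i x + H i x) \<in> fns X U"
  and sm_mult: "F \<in> fns X U \<Longrightarrow> H \<in> fns X U \<Longrightarrow> (\<lambda>i x. F i x * H i x) \<in> fns X U"
  and sm_restr: "openin (body X) V \<Longrightarrow> V \<subseteq> U \<Longrightarrow> F \<in> fns X U \<Longrightarrow> restr V F \<in> fns X V"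
  and sm_value_chart: "F \<in> fns X U \<Longrightarrow> x \<in> U \<inter> cdom X i \<inter> cdom X j \<Longrightarrow>
    coeff (F i x) {} = coeff (F j x) {}"
  and sm_bij: "U \<subseteq> cdom X i \<Longrightarrow>
    bij_betw (local_expr X i U) (fns X U) (sdom_fns (edim X) (odim X) (coord X i ` U))"
proof -
  note alg = sm_algebra[THEN spec, THEN mp, OF U]
  note out = alg[THEN conjunct1] and inv = alg[THEN conjunct2, THEN conjunct2, THEN conjunct1]
    and ops = alg[THEN conjunct2, THEN conjunct2, THEN conjunct2, THEN conjunct1]
    and res = alg[THEN conjunct2, THEN conjunct2, THEN conjunct2, THEN conjunct2]
  show "F \<in> fns X U \<Longrightarrow> x \<notin> U \<inter> cdom X i \<Longrightarrow> F i x = 0"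
    by (rule out[rule_format])
  show "const_sec X U r \<in> fns X U"
    by (rule alg[THEN conjunct2, THEN conjunct1, THEN spec])
  show "F \<in> fns X U \<Longrightarrow> invol_sec F \<in> fns X U"
    by (rule inv[rule_format])
  show "F \<in> fns X U \<Longrightarrow> H \<in> fns X U \<Longrightarrow> (\<lambda>i x. F i x + H i x) \<in> fns X U"
    by (rule ops[rule_format, THEN conjunct1])
  show "F \<in> fns X U \<Longrightarrow> H \<in> fns X U \<Longrightarrow> (\<lambda>i x. F i x * H i x) \<in> fns X U"
    by (rule ops[rule_format, THEN conjunct2])
  show "openin (body X) V \<Longrightarrow> V \<subseteq> U \<Longrightarrow> F \<in> fns X U \<Longrightarrow> restr V F \<in> fns X V"
    by (rule res[rule_format]) simp_all
  show "F \<in> fns X U \<Longrightarrow> x \<in> U \<inter> cdom X i \<inter> cdom X j \<Longrightarrow> coeff (F i x) {} = coeff (F j x) {}"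
    by (rule sm_values[rule_format, of U]) (use U in simp)
  show "U \<subseteq> cdom X i \<Longrightarrow>
      bij_betw (local_expr X i U) (fns X U) (sdom_fns (edim X) (odim X) (coord X i ` U))"
    using sm_charts U by simp
qed

lemma sm_zero: "(\<lambda>i x. 0) \<in> fns X U"
  using sm_const[of 0] unfolding const_sec_zero .

lemma const_sec_minus_one_mult:
  "F \<in> fns X U \<Longrightarrow> (\<lambda>i x. const_sec X U (- 1) i x * F i x) = (\<lambda>i x. - F i x)"
  using sm_outside[of F] by (auto simp: const_sec_def fun_eq_iff)

lemma sm_uminus: "F \<in> fns X U \<Longrightarrow> (\<lambda>i x. - F i x) \<in> fns X U"
  using sm_mult[OF sm_const, of F "- 1"] by (simp add: const_sec_minus_one_mult)

lemma value_at_chart: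
  assumes "F \<in> fns X U" "x \<in> U" "x \<in> cdom X i"
  shows "value_at X F x = coeff (F i x) {}"
  unfolding value_at_def using assms sm_value_chart[of F x] by (metis IntI someI)

end

lemma sm_glue: "(\<And>U. U \<in> \<U> \<Longrightarrow> openin (body X) U) \<Longrightarrow> (\<And>U. U \<in> \<U> \<Longrightarrow> restr U F \<in> fns X U) \<Longrightarrow>
    restr (\<Union>\<U>) F = F \<Longrightarrow> F \<in> fns X (\<Union>\<U>)"
  by (rule sm_gluing[rule_format]) simp

lemma local_expr_coord:
  assumes "U \<subseteq> cdom X i" "x \<in> U"
  shows "local_expr X i U F (coord X i x) = F i x"
proof -
  have "inv_into (cdom X i) (coord X i) (coord X i x) = x"
    using assms sm_inj by (auto intro: inv_into_f_f)
  then show ?thesis using assms by (auto simp: local_expr_def)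
qed

lemma sm_grass:
  assumes U: "openin (body X) U" and F: "F \<in> fns X U"
  shows "F i x \<in> grass (odim X)"
proof (cases "x \<in> U \<inter> cdom X i")
  case True
  let ?W = "U \<inter> cdom X i"
  have W: "openin (body X) ?W" using U sm_open_cdom by (rule openin_Int)
  have "restr ?W F \<in> fns X ?W" using sm_restr[OF U W] F by simp
  then have "local_expr X i ?W (restr ?W F) \<in> sdom_fns (edim X) (odim X) (coord X i ` ?W)"
    using sm_bij[OF W, of i] by (auto dest: bij_betwE)
  then have "local_expr X i ?W (restr ?W F) (coord X i x) \<in> grass (odim X)"
    by (simp add: sdom_fns_def)
  then show ?thesis using True by (simp add: local_expr_coord restr_def)
next
  case False
  then show ?thesis using sm_outside[OF U F] by (simp add: grass_def)
qed

end

lemma cdom_points: "supermanifold X \<Longrightarrow> x \<in> cdom X i \<Longrightarrow> x \<in> points X"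
  using sm_points by blast

section \<open>Products with the odd line\<close>

lemma times_R01_simps [simp]:
  "edim (times_R01 X) = edim X" "odim (times_R01 X) = Suc (odim X)" "body (times_R01 X) = body X"
  "cdom (times_R01 X) = cdom X" "coord (times_R01 X) = coord X"
  by (simp_all add: times_R01_def)

lemma times_R01_derived [simp]:
  "const_sec (times_R01 X) = const_sec X" "local_expr (times_R01 X) = local_expr X"
  "preim (times_R01 X) = preim X" "value_at (times_R01 X) = value_at X"
  by (simp_all add: const_sec_def local_expr_def preim_def value_at_def fun_eq_iff)

lemma fns_times_R01: "fns (times_R01 X) U =
    {(\<lambda>i x. F0 i x + gen (odim X) * F1 i x) | F0 F1. F0 \<in> fns X U \<and> F1 \<in> fns X U}"
  by (simp add: times_R01_def)

lemma fns_times_R01I: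
  "F0 \<in> fns X U \<Longrightarrow> F1 \<in> fns X U \<Longrightarrow> (\<lambda>i x. F0 i x + gen (odim X) * F1 i x) \<in> fns (times_R01 X) U"
  by (auto simp: fns_times_R01)

lemma fns_times_R01E:
  assumes "F \<in> fns (times_R01 X) U"
  obtains F0 F1 where "F0 \<in> fns X U" "F1 \<in> fns X U" "F = (\<lambda>i x. F0 i x + gen (odim X) * F1 i x)"
  using assms by (auto simp: fns_times_R01)

lemma local_expr_times_R01:
  "local_expr X i U (\<lambda>i x. F0 i x + gen n * F1 i x) =
    (\<lambda>y. local_expr X i U F0 y + gen n * local_expr X i U F1 y)"
  by (auto simp: local_expr_def)

lemma local_expr_invol_sec:
  "local_expr X i U (invol_sec F) = (\<lambda>y. ginvol (local_expr X i U F y))"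
  by (auto simp: local_expr_def invol_sec_def)

context
  fixes X :: supermfd
  assumes X: "supermanifold X"
begin

lemma local_expr_times_R01_in_sdom:
  assumes U: "openin (body X) U" "U \<subseteq> cdom X i" and F0: "F0 \<in> fns X U" and F1: "F1 \<in> fns X U"
  shows "local_expr X i U (\<lambda>i x. F0 i x + gen (odim X) * F1 i x)
    \<in> sdom_fns (edim X) (Suc (odim X)) (coord X i ` U)"
proof -
  let ?n = "odim X" and ?V = "coord X i ` U" and ?l = "local_expr X i U"
  have l: "?l F \<in> sdom_fns (edim X) ?n ?V" if "F \<in> fns X U" for F
    using bij_betwE[OF sm_bij[OF X U]] that by blast
  define f h where "f = ?l F0" and "h = ?l (invol_sec F1)"
  have f: "f \<in> sdom_fns (edim X) ?n ?V" and h: "h \<in> sdom_fns (edim X) ?n ?V"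
    unfolding f_def h_def using F0 F1 by (auto intro!: l sm_invol[OF X U(1)])
  have eq: "?l (\<lambda>i x. F0 i x + gen ?n * F1 i x) = (\<lambda>y. f y + gen ?n * ginvol (h y))"
    unfolding local_expr_times_R01 f_def h_def local_expr_invol_sec by simp
  have co: "coeff (f y + gen ?n * ginvol (h y)) K =
      (if ?n \<in> K then coeff (h y) (K - {?n}) else coeff (f y) K)" for y K
  proof (cases "finite K")
    case K: True
    have fh: "f y \<in> grass ?n" "h y \<in> grass ?n" using f h by (auto simp: sdom_fns_def)
    show ?thesis
    proof (cases "?n \<in> K \<and> K - {?n} \<subseteq> {..<?n}")
      case True
      then have "{k \<in> K. k < ?n} = K - {?n}" by auto
      moreover have "coeff (f y) K = 0" using True fh by (auto intro: coeff_grass)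
      ultimately show ?thesis using K True
        by (simp add: coeff_gen_mult coeff_ginvol flip: power_mult_distrib mult.assoc)
    next
      case False
      then have "coeff (f y) K = 0" "coeff (h y) (K - {?n}) = 0" if "?n \<in> K"
        using fh that by (auto intro!: coeff_grass)
      then show ?thesis using K by (simp add: coeff_gen_mult coeff_ginvol)
    qed
  qed simp
  have "f y + gen ?n * ginvol (h y) \<in> grass (Suc ?n)" for y
    unfolding grass_def
  proof (clarify)
    fix K x assume K: "coeff (f y + gen ?n * ginvol (h y)) K \<noteq> 0" and x: "x \<in> K"
    have "f y \<in> grass ?n" "h y \<in> grass ?n" using f h by (auto simp: sdom_fns_def)
    with K x show "x < Suc ?n" unfolding co by (cases "?n \<in> K") (fastforce simp: grass_def)+
  qed
  moreover have "smooth (edim X) ?V (\<lambda>y. coeff (f y + gen ?n * ginvol (h y)) K)" for K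
    unfolding co using f h by (cases "?n \<in> K") (simp_all add: sdom_fns_def)
  ultimately show ?thesis
    using f h unfolding eq by (simp add: sdom_fns_def)
qed

lemma sdom_decomp:
  assumes U: "openin (body X) U" "U \<subseteq> cdom X i"
    and f: "f \<in> sdom_fns (edim X) (Suc (odim X)) (coord X i ` U)"
  shows "f \<in> local_expr X i U ` fns (times_R01 X) U"
proof -
  let ?n = "odim X" and ?V = "coord X i ` U" and ?l = "local_expr X i U"
  have im: "?l ` fns X U = sdom_fns (edim X) ?n ?V"
    using sm_bij[OF X U] by (simp add: bij_betw_def)
  have gr: "f y \<in> grass (Suc ?n)" for y using f by (simp add: sdom_fns_def)
  have sm0: "smooth (edim X) ?V (\<lambda>y. 0)"
  proof -
    have "?l (\<lambda>i x. 0) \<in> sdom_fns (edim X) ?n ?V"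
      using im sm_zero[OF X U(1)] by blast
    then have "smooth (edim X) ?V (\<lambda>y. coeff (?l (\<lambda>i x. 0) y) {})" by (simp add: sdom_fns_def)
    then show ?thesis by (simp add: local_expr_def)
  qed
  have smf: "smooth (edim X) ?V (\<lambda>y. coeff (f y) K)" for K using f by (simp add: sdom_fns_def)
  have z: "f y = 0" if "y \<notin> ?V" for y using f that by (simp add: sdom_fns_def)
  have "(\<lambda>y. odd_pd ?n (gen ?n * f y)) \<in> sdom_fns (edim X) ?n ?V"
  proof -
    have co: "coeff (odd_pd ?n (gen ?n * f y)) K = (if ?n \<in> K then 0 else coeff (f y) K)" for y K
      by (cases "finite K") (auto simp: coeff_odd_pd_gen_mult)
    have "smooth (edim X) ?V (\<lambda>y. coeff (odd_pd ?n (gen ?n * f y)) K)" for K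
      unfolding co using sm0 smf by (cases "?n \<in> K") simp_all
    moreover have "odd_pd ?n (gen ?n * f y) \<in> grass ?n" for y
      using gr[of y] by (auto simp: grass_def co lessThan_Suc)
    ultimately show ?thesis using z by (simp add: sdom_fns_def)
  qed
  then obtain F0 where F0: "F0 \<in> fns X U" "?l F0 = (\<lambda>y. odd_pd ?n (gen ?n * f y))"
    using im by (metis imageE)
  have "(\<lambda>y. ginvol (odd_pd ?n (f y))) \<in> sdom_fns (edim X) ?n ?V"
  proof -
    have "smooth (edim X) ?V (\<lambda>y. coeff (ginvol (odd_pd ?n (f y))) K)" for K
      unfolding ginvol_odd_pd_grass[OF gr] using sm0 smf by (cases "?n \<in> K") simp_all
    moreover have "ginvol (odd_pd ?n (f y)) \<in> grass ?n" for y
      using gr[of y] unfolding grass_def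
      by (auto simp: ginvol_odd_pd_grass[OF gr] lessThan_Suc split: if_splits)
    ultimately show ?thesis using z by (simp add: sdom_fns_def)
  qed
  then obtain F1 where F1: "F1 \<in> fns X U" "?l F1 = (\<lambda>y. ginvol (odd_pd ?n (f y)))"
    using im by (metis imageE)
  have "f = ?l (\<lambda>i x. F0 i x + gen ?n * invol_sec F1 i x)"
    unfolding local_expr_times_R01 local_expr_invol_sec F0(2) F1(2) by (simp add: gen_decomp)
  then show ?thesis
    using fns_times_R01I[OF F0(1) sm_invol[OF X U(1) F1(1)]] by blast
qed

lemma times_R01_eqD:
  assumes U: "openin (body X) U"
    and F: "F0 \<in> fns X U" "F1 \<in> fns X U" and H: "H0 \<in> fns X U" "H1 \<in> fns X U"
    and eq: "(\<lambda>i x. F0 i x + gen (odim X) * F1 i x) = (\<lambda>i x. H0 i x + gen (odim X) * H1 i x)"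
  shows "F0 = H0" "F1 = H1"
proof -
  have "F0 i x + gen (odim X) * F1 i x = H0 i x + gen (odim X) * H1 i x" for i x
    using fun_cong[OF fun_cong[OF eq]] .
  from gen_decomp_eq[OF this] show "F0 = H0" "F1 = H1"
    using sm_grass[OF X U] F H by (simp_all add: fun_eq_iff)
qed

lemma supermanifold_times_R01: "supermanifold (times_R01 X)"
proof -
  let ?T = "times_R01 X" and ?n = "odim X"
  have top: "Hausdorff_space (body X)" "(\<Union>i. cdom X i) = points X"
    "\<forall>i. openin (coord_space (edim X)) (coord X i ` cdom X i) \<and>
        homeomorphic_map (subtopology (body X) (cdom X i))
          (subtopology (coord_space (edim X)) (coord X i ` cdom X i)) (coord X i)"
    by (insert X[unfolded supermanifold_def], (elim conjE, assumption)+)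
  have alg: "(\<forall>F\<in>fns ?T U. \<forall>i x. x \<notin> U \<inter> cdom X i \<longrightarrow> F i x = 0) \<and>
        (\<forall>r. const_sec X U r \<in> fns ?T U) \<and>
        (\<forall>F\<in>fns ?T U. invol_sec F \<in> fns ?T U) \<and>
        (\<forall>F\<in>fns ?T U. \<forall>H\<in>fns ?T U.
           (\<lambda>i x. F i x + H i x) \<in> fns ?T U \<and> (\<lambda>i x. F i x * H i x) \<in> fns ?T U) \<and>
        (\<forall>V. openin (body X) V \<and> V \<subseteq> U \<longrightarrow> (\<forall>F\<in>fns ?T U. restr V F \<in> fns ?T V))"
    if U: "openin (body X) U" for U
  proof (intro conjI ballI allI impI)
    fix F assume F: "F \<in> fns ?T U"
    obtain F0 F1 where F0: "F0 \<in> fns X U" "F1 \<in> fns X U"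
        "F = (\<lambda>i x. F0 i x + gen ?n * F1 i x)" using F by (rule fns_times_R01E)
    show "F i x = 0" if "x \<notin> U \<inter> cdom X i" for i x
      unfolding F0(3) sm_outside[OF X U F0(1) that] sm_outside[OF X U F0(2) that] by simp
    have "invol_sec F = (\<lambda>i x. invol_sec F0 i x + gen ?n * (- invol_sec F1 i x))"
      by (simp add: F0 invol_sec_def)
    then show "invol_sec F \<in> fns ?T U"
      using fns_times_R01I[OF sm_invol sm_uminus[OF _ _ sm_invol]] X U F0 by simp
    show "restr V F \<in> fns ?T V" if V: "openin (body X) V \<and> V \<subseteq> U" for V
    proof -
      have "restr V F = (\<lambda>i x. restr V F0 i x + gen ?n * restr V F1 i x)"
        by (simp add: F0 restr_def fun_eq_iff)
      then show ?thesis using fns_times_R01I[OF sm_restr sm_restr] X U V F0 by simp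
    qed
    fix H assume H: "H \<in> fns ?T U"
    obtain H0 H1 where H0: "H0 \<in> fns X U" "H1 \<in> fns X U"
        "H = (\<lambda>i x. H0 i x + gen ?n * H1 i x)" using H by (rule fns_times_R01E)
    have "(\<lambda>i x. F i x + H i x) = (\<lambda>i x. (F0 i x + H0 i x) + gen ?n * (F1 i x + H1 i x))"
      by (simp add: F0 H0 algebra_simps)
    then show "(\<lambda>i x. F i x + H i x) \<in> fns ?T U"
      using fns_times_R01I[OF sm_add sm_add] X U F0 H0 by simp
    have "F i x * H i x = F0 i x * H0 i x +
        gen ?n * (F1 i x * H0 i x + invol_sec F0 i x * H1 i x)" for i x
      by (simp add: F0 H0 gen_dual_mult invol_sec_def)
    then show "(\<lambda>i x. F i x * H i x) \<in> fns ?T U"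
      using fns_times_R01I[OF sm_mult sm_add[OF _ _ sm_mult sm_mult[OF _ _ sm_invol]]] X U F0 H0
      by simp
  next
    fix r
    have "(\<lambda>i x. const_sec X U r i x + gen ?n * 0) \<in> fns ?T U"
      by (rule fns_times_R01I[OF sm_const sm_zero]) (use X U in auto)
    then show "const_sec X U r \<in> fns ?T U" by simp
  qed
  have glue: "F \<in> fns ?T (\<Union>\<U>)"
    if U: "\<And>U. U \<in> \<U> \<Longrightarrow> openin (body X) U" "\<And>U. U \<in> \<U> \<Longrightarrow> restr U F \<in> fns ?T U"
      and F: "restr (\<Union>\<U>) F = F" for \<U> F
  proof -
    define F0 F1 where "F0 = (\<lambda>i x. odd_pd ?n (gen ?n * F i x))"
      and "F1 = (\<lambda>i x. odd_pd ?n (F i x))"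
    have r: "restr U F0 \<in> fns X U \<and> restr U F1 \<in> fns X U" if "U \<in> \<U>" for U
    proof -
      obtain H0 H1 where H: "H0 \<in> fns X U" "H1 \<in> fns X U"
        "restr U F = (\<lambda>i x. H0 i x + gen ?n * H1 i x)" using U(2)[OF \<open>U \<in> \<U>\<close>] by (rule fns_times_R01E)
      have "restr U F0 i x = odd_pd ?n (gen ?n * restr U F i x)"
        "restr U F1 i x = odd_pd ?n (restr U F i x)" for i x
        by (auto simp: restr_def F0_def F1_def)
      then have "restr U F0 = H0" "restr U F1 = H1"
        using sm_grass[OF X U(1)[OF \<open>U \<in> \<U>\<close>]] H by (simp_all add: gen_components fun_eq_iff)
      then show ?thesis using H by simp
    qed
    have "F i x = 0" if "x \<notin> \<Union>\<U>" for i x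
      using F that by (metis (no_types, lifting) restr_def)
    then have "restr (\<Union>\<U>) F0 = F0" "restr (\<Union>\<U>) F1 = F1"
      by (auto simp: restr_def F0_def F1_def fun_eq_iff)
    then have "F0 \<in> fns X (\<Union>\<U>)" "F1 \<in> fns X (\<Union>\<U>)"
      using sm_glue[OF X] U r by blast+
    from fns_times_R01I[OF this] show ?thesis by (simp add: F0_def F1_def gen_decomp)
  qed
  have bij: "bij_betw (local_expr X i U) (fns ?T U) (sdom_fns (edim X) (Suc ?n) (coord X i ` U))"
    if U: "openin (body X) U" "U \<subseteq> cdom X i" for i U
    unfolding bij_betw_def
  proof
    show "inj_on (local_expr X i U) (fns ?T U)"
    proof (rule inj_onI)
      fix F H assume FH: "F \<in> fns ?T U" "H \<in> fns ?T U" and eq: "local_expr X i U F = local_expr X i U H"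
      obtain F0 F1 where F: "F0 \<in> fns X U" "F1 \<in> fns X U"
        "F = (\<lambda>i x. F0 i x + gen ?n * F1 i x)" using FH(1) by (rule fns_times_R01E)
      obtain H0 H1 where H: "H0 \<in> fns X U" "H1 \<in> fns X U"
        "H = (\<lambda>i x. H0 i x + gen ?n * H1 i x)" using FH(2) by (rule fns_times_R01E)
      have b: "bij_betw (local_expr X i U) (fns X U) (sdom_fns (edim X) ?n (coord X i ` U))"
        by (rule sm_bij[OF X U])
      have gr: "local_expr X i U K y \<in> grass ?n" if "K \<in> fns X U" for K y
        using bij_betwE[OF b] that by (auto simp: sdom_fns_def)
      have "local_expr X i U F0 y + gen ?n * local_expr X i U F1 y =
          local_expr X i U H0 y + gen ?n * local_expr X i U H1 y" for y
        using fun_cong[OF eq] unfolding F H local_expr_times_R01 .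
      from gen_decomp_eq[OF this] have "local_expr X i U F0 = local_expr X i U H0"
        "local_expr X i U F1 = local_expr X i U H1"
        using gr F(1,2) H(1,2) by (simp_all add: fun_eq_iff)
      then have "F0 = H0" "F1 = H1"
        using b F H by (auto simp: bij_betw_def dest: inj_onD)
      then show "F = H" using F H by simp
    qed
    show "local_expr X i U ` fns ?T U = sdom_fns (edim X) (Suc ?n) (coord X i ` U)"
      using sdom_decomp[OF U] local_expr_times_R01_in_sdom[OF U] by (auto elim!: fns_times_R01E)
  qed
  have val: "coeff (F i x) {} = coeff (F j x) {}"
    if "openin (body X) U" "F \<in> fns ?T U" "x \<in> U \<inter> cdom X i \<inter> cdom X j" for U F i j x
    using that sm_value_chart[OF X] by (elim fns_times_R01E) auto
  show ?thesis
    unfolding supermanifold_def times_R01_simps times_R01_derived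
    by (intro conjI, rule top(1), rule allI, rule sm_open_cdom[OF X], rule top(2), rule top(3),
        (intro allI impI, rule alg, assumption),
        (intro allI impI, elim conjE, rule glue, blast, blast, assumption),
        (intro allI impI, elim conjE, rule bij, assumption+),
        (intro allI impI, elim conjE, rule val, assumption+))
qed

lemma times_R01_incl: "openin (body X) U \<Longrightarrow> F \<in> fns X U \<Longrightarrow> F \<in> fns (times_R01 X) U"
  using fns_times_R01I[OF _ sm_zero[OF X], of F U] by simp

lemma times_R01_gen_mult:
  assumes U: "openin (body X) U" and F: "F \<in> fns (times_R01 X) U"
  shows "(\<lambda>i x. gen (odim X) * F i x) \<in> fns (times_R01 X) U"
proof -
  obtain F0 F1 where F: "F0 \<in> fns X U" "F1 \<in> fns X U"
    "F = (\<lambda>i x. F0 i x + gen (odim X) * F1 i x)" using F by (rule fns_times_R01E)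
  have "(\<lambda>i x. 0 + gen (odim X) * F0 i x) \<in> fns (times_R01 X) U"
    by (rule fns_times_R01I[OF sm_zero[OF X U] F(1)])
  then show ?thesis by (simp add: F distrib_left)
qed

end

section \<open>Morphisms\<close>

lemma Mor_sheaf:
  assumes "\<phi> \<in> Mor X Y"
  shows "\<forall>V. openin (body Y) V \<longrightarrow>
        pull \<phi> V \<in> fns Y V \<rightarrow>\<^sub>E fns X (preim X \<phi> V) \<and>
        (\<forall>r. pull \<phi> V (const_sec Y V r) = const_sec X (preim X \<phi> V) r) \<and>
        (\<forall>F\<in>fns Y V. pull \<phi> V (invol_sec F) = invol_sec (pull \<phi> V F)) \<and>
        (\<forall>F\<in>fns Y V. \<forall>H\<in>fns Y V.
           pull \<phi> V (\<lambda>i x. F i x + H i x) = (\<lambda>i x. pull \<phi> V F i x + pull \<phi> V H i x) \<and>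
           pull \<phi> V (\<lambda>i x. F i x * H i x) = (\<lambda>i x. pull \<phi> V F i x * pull \<phi> V H i x)) \<and>
        (\<forall>W. openin (body Y) W \<and> W \<subseteq> V \<longrightarrow>
           (\<forall>F\<in>fns Y V. pull \<phi> W (restr W F) = restr (preim X \<phi> W) (pull \<phi> V F))) \<and>
        (\<forall>F\<in>fns Y V. \<forall>x\<in>preim X \<phi> V. value_at X (pull \<phi> V F) x = value_at Y F (mmap \<phi> x))"
  by (rule assms[unfolded Mor_def mem_Collect_eq, THEN conjunct2, THEN conjunct2, THEN conjunct2])

context
  fixes X Y \<phi>
  assumes \<phi>: "\<phi> \<in> Mor X Y"
begin

lemma Mor_ext: "mmap \<phi> \<in> extensional (points X)"
  and Mor_cont: "continuous_map (body X) (body Y) (mmap \<phi>)"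
  and Mor_nonopen: "\<not> openin (body Y) V \<Longrightarrow> pull \<phi> V = (\<lambda>_. undefined)"
proof -
  note a = \<phi>[unfolded Mor_def mem_Collect_eq]
  show "mmap \<phi> \<in> extensional (points X)" by (rule a[THEN conjunct1])
  show "continuous_map (body X) (body Y) (mmap \<phi>)" by (rule a[THEN conjunct2, THEN conjunct1])
  show "\<not> openin (body Y) V \<Longrightarrow> pull \<phi> V = (\<lambda>_. undefined)"
    by (rule a[THEN conjunct2, THEN conjunct2, THEN conjunct1, THEN spec, THEN mp])
qed

lemma Mor_point: "x \<in> points X \<Longrightarrow> mmap \<phi> x \<in> points Y"
  by (rule continuous_map_image_subset_topspace[OF Mor_cont, THEN subsetD, OF imageI])

lemma open_preim: "openin (body Y) V \<Longrightarrow> openin (body X) (preim X \<phi> V)"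
  unfolding preim_def by (rule openin_continuous_map_preimage[OF Mor_cont])

context
  fixes V
  assumes V: "openin (body Y) V"
begin

lemma Mor_pull_ext: "pull \<phi> V \<in> fns Y V \<rightarrow>\<^sub>E fns X (preim X \<phi> V)"
  and Mor_const: "pull \<phi> V (const_sec Y V r) = const_sec X (preim X \<phi> V) r"
  and Mor_invol: "F \<in> fns Y V \<Longrightarrow> pull \<phi> V (invol_sec F) = invol_sec (pull \<phi> V F)"
  and Mor_add: "F \<in> fns Y V \<Longrightarrow> H \<in> fns Y V \<Longrightarrow>
    pull \<phi> V (\<lambda>i x. F i x + H i x) = (\<lambda>i x. pull \<phi> V F i x + pull \<phi> V H i x)"
  and Mor_mult: "F \<in> fns Y V \<Longrightarrow> H \<in> fns Y V \<Longrightarrow>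
    pull \<phi> V (\<lambda>i x. F i x * H i x) = (\<lambda>i x. pull \<phi> V F i x * pull \<phi> V H i x)"
  and Mor_restr: "openin (body Y) W \<Longrightarrow> W \<subseteq> V \<Longrightarrow> F \<in> fns Y V \<Longrightarrow>
    pull \<phi> W (restr W F) = restr (preim X \<phi> W) (pull \<phi> V F)"
  and Mor_value: "F \<in> fns Y V \<Longrightarrow> x \<in> preim X \<phi> V \<Longrightarrow>
    value_at X (pull \<phi> V F) x = value_at Y F (mmap \<phi> x)"
proof -
  note a = Mor_sheaf[OF \<phi>, THEN spec, THEN mp, OF V]
  show "pull \<phi> V \<in> fns Y V \<rightarrow>\<^sub>E fns X (preim X \<phi> V)" by (rule a[THEN conjunct1])
  note b = a[THEN conjunct2]
  show "pull \<phi> V (const_sec Y V r) = const_sec X (preim X \<phi> V) r"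
    by (rule b[THEN conjunct1, THEN spec])
  note c = b[THEN conjunct2]
  show "F \<in> fns Y V \<Longrightarrow> pull \<phi> V (invol_sec F) = invol_sec (pull \<phi> V F)"
    by (rule c[THEN conjunct1, THEN bspec])
  note d = c[THEN conjunct2]
  show "F \<in> fns Y V \<Longrightarrow> H \<in> fns Y V \<Longrightarrow>
    pull \<phi> V (\<lambda>i x. F i x + H i x) = (\<lambda>i x. pull \<phi> V F i x + pull \<phi> V H i x)"
    by (rule d[THEN conjunct1, THEN bspec, THEN bspec, THEN conjunct1])
  show "F \<in> fns Y V \<Longrightarrow> H \<in> fns Y V \<Longrightarrow>
    pull \<phi> V (\<lambda>i x. F i x * H i x) = (\<lambda>i x. pull \<phi> V F i x * pull \<phi> V H i x)"
    by (rule d[THEN conjunct1, THEN bspec, THEN bspec, THEN conjunct2])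
  note e = d[THEN conjunct2]
  show "openin (body Y) W \<Longrightarrow> W \<subseteq> V \<Longrightarrow> F \<in> fns Y V \<Longrightarrow>
    pull \<phi> W (restr W F) = restr (preim X \<phi> W) (pull \<phi> V F)"
    by (rule e[THEN conjunct1, rule_format]) simp_all
  show "F \<in> fns Y V \<Longrightarrow> x \<in> preim X \<phi> V \<Longrightarrow>
    value_at X (pull \<phi> V F) x = value_at Y F (mmap \<phi> x)"
    by (rule e[THEN conjunct2, rule_format])
qed

lemma Mor_fns: "F \<in> fns Y V \<Longrightarrow> pull \<phi> V F \<in> fns X (preim X \<phi> V)"
  using Mor_pull_ext by (rule PiE_mem)

lemma Mor_zero: "pull \<phi> V (\<lambda>i x. 0) = (\<lambda>i x. 0)"
  using Mor_const[of 0] unfolding const_sec_zero .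

end

end

lemma MorI:
  assumes "mmap \<phi> \<in> extensional (points X)" "continuous_map (body X) (body Y) (mmap \<phi>)"
    and "\<And>V. \<not> openin (body Y) V \<Longrightarrow> pull \<phi> V = (\<lambda>_. undefined)"
    and "\<And>V. openin (body Y) V \<Longrightarrow> pull \<phi> V \<in> extensional (fns Y V)"
    and "\<And>V F. openin (body Y) V \<Longrightarrow> F \<in> fns Y V \<Longrightarrow> pull \<phi> V F \<in> fns X (preim X \<phi> V)"
    and "\<And>V r. openin (body Y) V \<Longrightarrow> pull \<phi> V (const_sec Y V r) = const_sec X (preim X \<phi> V) r"
    and "\<And>V F. openin (body Y) V \<Longrightarrow> F \<in> fns Y V \<Longrightarrow>
      pull \<phi> V (invol_sec F) = invol_sec (pull \<phi> V F)"
    and "\<And>V F H. openin (body Y) V \<Longrightarrow> F \<in> fns Y V \<Longrightarrow> H \<in> fns Y V \<Longrightarrow>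
      pull \<phi> V (\<lambda>i x. F i x + H i x) = (\<lambda>i x. pull \<phi> V F i x + pull \<phi> V H i x)"
    and "\<And>V F H. openin (body Y) V \<Longrightarrow> F \<in> fns Y V \<Longrightarrow> H \<in> fns Y V \<Longrightarrow>
      pull \<phi> V (\<lambda>i x. F i x * H i x) = (\<lambda>i x. pull \<phi> V F i x * pull \<phi> V H i x)"
    and "\<And>V W F. openin (body Y) V \<Longrightarrow> openin (body Y) W \<Longrightarrow> W \<subseteq> V \<Longrightarrow> F \<in> fns Y V \<Longrightarrow>
      pull \<phi> W (restr W F) = restr (preim X \<phi> W) (pull \<phi> V F)"
    and "\<And>V F x. openin (body Y) V \<Longrightarrow> F \<in> fns Y V \<Longrightarrow> x \<in> preim X \<phi> V \<Longrightarrow>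
      value_at X (pull \<phi> V F) x = value_at Y F (mmap \<phi> x)"
  shows "\<phi> \<in> Mor X Y"
proof -
  have P: "pull \<phi> V \<in> fns Y V \<rightarrow>\<^sub>E fns X (preim X \<phi> V)" if V: "openin (body Y) V" for V
    using assms(5)[OF V] extensional_arb[OF assms(4)[OF V]] by (rule PiE_I)
  show ?thesis
    unfolding Mor_def mem_Collect_eq
    by (intro conjI allI impI ballI, rule assms(1), rule assms(2), rule assms(3), assumption,
        rule P, assumption, rule assms(6), assumption, rule assms(7), assumption+, rule assms(8), assumption+,
        rule assms(9), assumption+, (elim conjE, rule assms(10), assumption+), rule assms(11))
qed

lemma Mor_eqI:
  assumes \<phi>: "\<phi> \<in> Mor X Y" and \<psi>: "\<psi> \<in> Mor X Y"
    and "\<And>x. x \<in> points X \<Longrightarrow> mmap \<phi> x = mmap \<psi> x"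
    and pl: "\<And>V F. openin (body Y) V \<Longrightarrow> F \<in> fns Y V \<Longrightarrow> pull \<phi> V F = pull \<psi> V F"
  shows "\<phi> = \<psi>"
proof -
  have "mmap \<phi> = mmap \<psi>"
    using Mor_ext[OF \<phi>] Mor_ext[OF \<psi>] assms(3) by (rule extensionalityI)
  moreover have "pull \<phi> V = pull \<psi> V" for V
  proof (cases "openin (body Y) V")
    case True
    have "pull \<phi> V \<in> extensional (fns Y V)" "pull \<psi> V \<in> extensional (fns Y V)"
      using Mor_pull_ext[OF \<phi> True] Mor_pull_ext[OF \<psi> True] by (simp_all add: PiE_def)
    then show ?thesis using pl[OF True] by (rule extensionalityI)
  next
    case False
    then show ?thesis by (simp add: Mor_nonopen[OF \<phi>] Mor_nonopen[OF \<psi>])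
  qed
  ultimately show ?thesis by (simp add: mor.equality fun_eq_iff)
qed

lemma mmap_mcomp: "x \<in> points X \<Longrightarrow> mmap (mcomp X Y Z \<psi> \<phi>) x = mmap \<psi> (mmap \<phi> x)"
  by (simp add: mcomp_def)

lemma pull_mcomp: "openin (body Z) V \<Longrightarrow> F \<in> fns Z V \<Longrightarrow>
    pull (mcomp X Y Z \<psi> \<phi>) V F = pull \<phi> (preim Y \<psi> V) (pull \<psi> V F)"
  by (simp add: mcomp_def)

lemma preim_mcomp: "\<phi> \<in> Mor X Y \<Longrightarrow> preim X (mcomp X Y Z \<psi> \<phi>) V = preim X \<phi> (preim Y \<psi> V)"
  using Mor_point by (auto simp: preim_def mmap_mcomp)

lemma preim_mono: "W \<subseteq> V \<Longrightarrow> preim X \<phi> W \<subseteq> preim X \<phi> V"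
  by (auto simp: preim_def)

context
  fixes X Y Z \<phi> \<psi>
  assumes Z: "supermanifold Z" and \<phi>: "\<phi> \<in> Mor X Y" and \<psi>: "\<psi> \<in> Mor Y Z"
begin

lemma mcomp_in_Mor: "mcomp X Y Z \<psi> \<phi> \<in> Mor X Z"
proof (rule MorI)
  let ?c = "mcomp X Y Z \<psi> \<phi>"
  show "mmap ?c \<in> extensional (points X)"
    by (simp add: mcomp_def)
  have "continuous_map (body X) (body Z) (mmap \<psi> \<circ> mmap \<phi>)"
    using Mor_cont[OF \<phi>] Mor_cont[OF \<psi>] by (rule continuous_map_compose)
  then show "continuous_map (body X) (body Z) (mmap ?c)"
    by (rule continuous_map_eq) (simp add: mmap_mcomp)
  show "\<not> openin (body Z) V \<Longrightarrow> pull ?c V = (\<lambda>_. undefined)" for V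
    by (simp add: mcomp_def)
  fix V assume V: "openin (body Z) V"
  let ?V = "preim Y \<psi> V"
  have V': "openin (body Y) ?V" by (rule open_preim[OF \<psi> V])
  show "pull ?c V \<in> extensional (fns Z V)"
    using V by (simp add: mcomp_def)
  show "pull ?c V F \<in> fns X (preim X ?c V)" if F: "F \<in> fns Z V" for F
    unfolding preim_mcomp[OF \<phi>] pull_mcomp[OF V F]
    by (rule Mor_fns[OF \<phi> V' Mor_fns[OF \<psi> V F]])
  show "pull ?c V (const_sec Z V r) = const_sec X (preim X ?c V) r" for r
    unfolding pull_mcomp[OF V sm_const[OF Z V]]
    by (simp add: Mor_const[OF \<psi> V] Mor_const[OF \<phi> V'] preim_mcomp[OF \<phi>])
  show "pull ?c V (invol_sec F) = invol_sec (pull ?c V F)" if F: "F \<in> fns Z V" for F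
    unfolding pull_mcomp[OF V F] pull_mcomp[OF V sm_invol[OF Z V F]]
    by (simp add: Mor_invol[OF \<psi> V F] Mor_invol[OF \<phi> V' Mor_fns[OF \<psi> V F]])
  show "pull ?c V (\<lambda>i x. F i x + H i x) = (\<lambda>i x. pull ?c V F i x + pull ?c V H i x)"
    if F: "F \<in> fns Z V" and H: "H \<in> fns Z V" for F H
    unfolding pull_mcomp[OF V F] pull_mcomp[OF V H] pull_mcomp[OF V sm_add[OF Z V F H]]
      Mor_add[OF \<psi> V F H]
    by (rule Mor_add[OF \<phi> V' Mor_fns[OF \<psi> V F] Mor_fns[OF \<psi> V H]])
  show "pull ?c V (\<lambda>i x. F i x * H i x) = (\<lambda>i x. pull ?c V F i x * pull ?c V H i x)"
    if F: "F \<in> fns Z V" and H: "H \<in> fns Z V" for F H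
    unfolding pull_mcomp[OF V F] pull_mcomp[OF V H] pull_mcomp[OF V sm_mult[OF Z V F H]]
      Mor_mult[OF \<psi> V F H]
    by (rule Mor_mult[OF \<phi> V' Mor_fns[OF \<psi> V F] Mor_fns[OF \<psi> V H]])
  show "pull ?c W (restr W F) = restr (preim X ?c W) (pull ?c V F)"
    if W: "openin (body Z) W" "W \<subseteq> V" and F: "F \<in> fns Z V" for W F
    unfolding pull_mcomp[OF V F] pull_mcomp[OF W(1) sm_restr[OF Z V W F]]
      Mor_restr[OF \<psi> V W F] preim_mcomp[OF \<phi>]
    by (rule Mor_restr[OF \<phi> V' open_preim[OF \<psi> W(1)] preim_mono[OF W(2)] Mor_fns[OF \<psi> V F]])
  show "value_at X (pull ?c V F) x = value_at Z F (mmap ?c x)"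
    if F: "F \<in> fns Z V" and x: "x \<in> preim X ?c V" for F x
  proof -
    have x': "x \<in> preim X \<phi> ?V" using x by (simp add: preim_mcomp[OF \<phi>])
    then have "mmap \<phi> x \<in> ?V" "x \<in> points X" by (simp_all add: preim_def)
    then show ?thesis
      unfolding pull_mcomp[OF V F] Mor_value[OF \<phi> V' Mor_fns[OF \<psi> V F] x']
      by (simp add: Mor_value[OF \<psi> V F] mmap_mcomp)
  qed
qed

end

lemma mcomp_assoc:
  assumes Z: "supermanifold Z" and U: "supermanifold U"
    and \<phi>: "\<phi> \<in> Mor X Y" and \<psi>: "\<psi> \<in> Mor Y Z" and \<eta>: "\<eta> \<in> Mor Z U"
  shows "mcomp X Z U \<eta> (mcomp X Y Z \<psi> \<phi>) = mcomp X Y U (mcomp Y Z U \<eta> \<psi>) \<phi>"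
proof (rule Mor_eqI)
  show "mcomp X Z U \<eta> (mcomp X Y Z \<psi> \<phi>) \<in> Mor X U"
    using mcomp_in_Mor[OF U mcomp_in_Mor[OF Z \<phi> \<psi>] \<eta>] .
  show "mcomp X Y U (mcomp Y Z U \<eta> \<psi>) \<phi> \<in> Mor X U"
    using mcomp_in_Mor[OF U \<phi> mcomp_in_Mor[OF U \<psi> \<eta>]] .
  show "mmap (mcomp X Z U \<eta> (mcomp X Y Z \<psi> \<phi>)) x = mmap (mcomp X Y U (mcomp Y Z U \<eta> \<psi>) \<phi>) x"
    if "x \<in> points X" for x
    using that Mor_point[OF \<phi>] by (simp add: mmap_mcomp)
  show "pull (mcomp X Z U \<eta> (mcomp X Y Z \<psi> \<phi>)) V F = pull (mcomp X Y U (mcomp Y Z U \<eta> \<psi>) \<phi>) V F"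
    if V: "openin (body U) V" and F: "F \<in> fns U V" for V F
    by (simp add: pull_mcomp[OF V F] pull_mcomp[OF open_preim[OF \<eta> V] Mor_fns[OF \<eta> V F]]
        preim_mcomp[OF \<psi>])
qed

lemma mmap_const_mor: "x \<in> points X \<Longrightarrow> mmap (const_mor X Y e) x = e"
  by (simp add: const_mor_def)

lemma pull_const_mor: "openin (body Y) V \<Longrightarrow> F \<in> fns Y V \<Longrightarrow>
    pull (const_mor X Y e) V F = const_sec X (if e \<in> V then points X else {}) (value_at Y F e)"
  by (simp add: const_mor_def)

lemma preim_const_mor: "preim X (const_mor X Y e) V = (if e \<in> V then points X else {})"
  by (auto simp: preim_def mmap_const_mor)

lemma const_sec_empty: "const_sec X {} r = (\<lambda>i x. 0)"
  by (simp add: const_sec_def)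

lemma value_at_arith:
  "value_at X (\<lambda>i x. F i x + H i x) x = value_at X F x + value_at X H x"
  "value_at X (\<lambda>i x. F i x * H i x) x = value_at X F x * value_at X H x"
  "value_at X (\<lambda>i x. r *\<^sub>R F i x) x = r * value_at X F x"
  "value_at X (invol_sec F) x = value_at X F x"
  "value_at X (\<lambda>i x. 0) x = 0"
  "x \<in> U \<Longrightarrow> value_at X (restr U F) x = value_at X F x"
  by (simp_all add: value_at_def coeff_mult_empty invol_sec_def restr_def)

lemma value_at_const_sec:
  "supermanifold X \<Longrightarrow> openin (body X) U \<Longrightarrow> x \<in> U \<Longrightarrow> value_at X (const_sec X U r) x = r"
proof -
  assume X: "supermanifold X" and U: "openin (body X) U" and x: "x \<in> U"
  obtain i where i: "x \<in> cdom X i" using sm_points[OF X] openin_subset[OF U] x by auto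
  show ?thesis
    unfolding value_at_chart[OF X U sm_const[OF X U] x i]
    using x i by (simp add: const_sec_def coeff_of_real)
qed

lemma const_mor_in_Mor:
  assumes X: "supermanifold X" and Y: "supermanifold Y" and e: "e \<in> points Y"
  shows "const_mor X Y e \<in> Mor X Y"
proof (rule MorI)
  let ?c = "const_mor X Y e"
  have o: "openin (body X) (if e \<in> V then points X else {})" for V by simp
  show "mmap ?c \<in> extensional (points X)"
    by (simp add: const_mor_def)
  have "continuous_map (body X) (body Y) (\<lambda>_. e)" using e by simp
  then show "continuous_map (body X) (body Y) (mmap ?c)"
    by (rule continuous_map_eq) (simp add: mmap_const_mor)
  show "\<not> openin (body Y) V \<Longrightarrow> pull ?c V = (\<lambda>_. undefined)" for V
    by (simp add: const_mor_def)
  fix V assume V: "openin (body Y) V"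
  note pl = pull_const_mor[OF V]
  show "pull ?c V \<in> extensional (fns Y V)"
    using V by (simp add: const_mor_def)
  show "pull ?c V F \<in> fns X (preim X ?c V)" if F: "F \<in> fns Y V" for F
    unfolding pl[OF F] preim_const_mor by (rule sm_const[OF X o])
  show "pull ?c V (const_sec Y V r) = const_sec X (preim X ?c V) r" for r
    unfolding pl[OF sm_const[OF Y V]] preim_const_mor
    by (simp add: value_at_const_sec[OF Y V] const_sec_empty)
  show "pull ?c V (invol_sec F) = invol_sec (pull ?c V F)" if F: "F \<in> fns Y V" for F
    unfolding pl[OF F] pl[OF sm_invol[OF Y V F]] value_at_arith
    by (simp add: const_sec_def invol_sec_def fun_eq_iff)
  show "pull ?c V (\<lambda>i x. F i x + H i x) = (\<lambda>i x. pull ?c V F i x + pull ?c V H i x)"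
    if F: "F \<in> fns Y V" and H: "H \<in> fns Y V" for F H
    unfolding pl[OF F] pl[OF H] pl[OF sm_add[OF Y V F H]] value_at_arith
    by (simp add: const_sec_def fun_eq_iff)
  show "pull ?c V (\<lambda>i x. F i x * H i x) = (\<lambda>i x. pull ?c V F i x * pull ?c V H i x)"
    if F: "F \<in> fns Y V" and H: "H \<in> fns Y V" for F H
    unfolding pl[OF F] pl[OF H] pl[OF sm_mult[OF Y V F H]] value_at_arith
    by (simp add: const_sec_def fun_eq_iff)
  show "pull ?c W (restr W F) = restr (preim X ?c W) (pull ?c V F)"
    if W: "openin (body Y) W" "W \<subseteq> V" and F: "F \<in> fns Y V" for W F
    unfolding pl[OF F] pull_const_mor[OF W(1) sm_restr[OF Y V W F]] preim_const_mor
    using W(2) value_at_arith(6)[of e W Y F]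
    by (cases "e \<in> W") (auto simp: const_sec_def restr_def fun_eq_iff)
  show "value_at X (pull ?c V F) x = value_at Y F (mmap ?c x)"
    if F: "F \<in> fns Y V" and x: "x \<in> preim X ?c V" for F x
    using x value_at_const_sec[OF X openin_topspace]
    by (auto simp: pl[OF F] preim_const_mor mmap_const_mor split: if_splits)
qed

lemma mcomp_const_mor_right:
  assumes X: "supermanifold X" and Y: "supermanifold Y" and Z: "supermanifold Z"
    and e: "e \<in> points Y" and \<psi>: "\<psi> \<in> Mor Y Z"
  shows "mcomp X Y Z \<psi> (const_mor X Y e) = const_mor X Z (mmap \<psi> e)"
proof (rule Mor_eqI)
  have c: "const_mor X Y e \<in> Mor X Y" by (rule const_mor_in_Mor[OF X Y e])
  show "mcomp X Y Z \<psi> (const_mor X Y e) \<in> Mor X Z" by (rule mcomp_in_Mor[OF Z c \<psi>])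
  show "const_mor X Z (mmap \<psi> e) \<in> Mor X Z"
    by (rule const_mor_in_Mor[OF X Z Mor_point[OF \<psi> e]])
  show "x \<in> points X \<Longrightarrow> mmap (mcomp X Y Z \<psi> (const_mor X Y e)) x = mmap (const_mor X Z (mmap \<psi> e)) x" for x
    by (simp add: mmap_mcomp mmap_const_mor)
  show "pull (mcomp X Y Z \<psi> (const_mor X Y e)) V F = pull (const_mor X Z (mmap \<psi> e)) V F"
    if V: "openin (body Z) V" and F: "F \<in> fns Z V" for V F
  proof -
    have "e \<in> preim Y \<psi> V \<longleftrightarrow> mmap \<psi> e \<in> V" using e by (simp add: preim_def)
    then show ?thesis
      unfolding pull_mcomp[OF V F] pull_const_mor[OF V F]
        pull_const_mor[OF open_preim[OF \<psi> V] Mor_fns[OF \<psi> V F]]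
      by (simp add: Mor_value[OF \<psi> V F] const_sec_empty)
  qed
qed

lemma mcomp_const_mor_left:
  assumes X: "supermanifold X" and Y: "supermanifold Y" and Z: "supermanifold Z"
    and e: "e \<in> points Z" and \<phi>: "\<phi> \<in> Mor X Y"
  shows "mcomp X Y Z (const_mor Y Z e) \<phi> = const_mor X Z e"
proof (rule Mor_eqI)
  have c: "const_mor Y Z e \<in> Mor Y Z" by (rule const_mor_in_Mor[OF Y Z e])
  show "mcomp X Y Z (const_mor Y Z e) \<phi> \<in> Mor X Z" by (rule mcomp_in_Mor[OF Z \<phi> c])
  show "const_mor X Z e \<in> Mor X Z" by (rule const_mor_in_Mor[OF X Z e])
  show "x \<in> points X \<Longrightarrow> mmap (mcomp X Y Z (const_mor Y Z e) \<phi>) x = mmap (const_mor X Z e) x" for x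
    by (simp add: mmap_mcomp mmap_const_mor Mor_point[OF \<phi>])
  show "pull (mcomp X Y Z (const_mor Y Z e) \<phi>) V F = pull (const_mor X Z e) V F"
    if V: "openin (body Z) V" and F: "F \<in> fns Z V" for V F
  proof -
    have "preim X \<phi> (points Y) = points X" "preim X \<phi> {} = {}"
      using Mor_point[OF \<phi>] by (auto simp: preim_def)
    then show ?thesis
      unfolding pull_mcomp[OF V F] pull_const_mor[OF V F] preim_const_mor
      using Mor_const[OF \<phi> openin_topspace] Mor_const[OF \<phi> openin_empty] by simp
  qed
qed

lemma mmap_pr_R01: "x \<in> points X \<Longrightarrow> mmap (pr_R01 X) x = x"
  by (simp add: pr_R01_def)

lemma pull_pr_R01: "openin (body X) V \<Longrightarrow> F \<in> fns X V \<Longrightarrow> pull (pr_R01 X) V F = F"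
  by (simp add: pr_R01_def)

lemma preim_pr_R01: "openin (body X) V \<Longrightarrow> preim X (pr_R01 X) V = V"
  using openin_subset[of "body X" V] by (auto simp: preim_def mmap_pr_R01)

text \<open>As normalised families, the projection \<open>X \<times> \<real>\<^bsup>0|1\<^esup> \<rightarrow> X\<close> and the identity of \<open>X\<close> are the
  same object.\<close>

lemma pr_R01_in_Mor:
  assumes X: "supermanifold X"
  shows "pr_R01 X \<in> Mor X X" "pr_R01 X \<in> Mor (times_R01 X) X"
proof -
  have *: "pr_R01 X \<in> Mor T X"
    if T: "body T = body X" "value_at T = value_at X" "const_sec T = const_sec X"
      and fns: "\<And>V F. openin (body X) V \<Longrightarrow> F \<in> fns X V \<Longrightarrow> F \<in> fns T V" for T
  proof (rule MorI)
    let ?c = "pr_R01 X"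
    have p: "preim T ?c V = V" if "openin (body X) V" for V
      using preim_pr_R01[OF that] T(1) by (simp add: preim_def)
    show "mmap ?c \<in> extensional (points T)" by (simp add: pr_R01_def T)
    have "continuous_map (body X) (body X) id" by simp
    then show "continuous_map (body T) (body X) (mmap ?c)"
      unfolding T by (rule continuous_map_eq) (simp add: mmap_pr_R01)
    show "\<not> openin (body X) V \<Longrightarrow> pull ?c V = (\<lambda>_. undefined)" for V
      by (simp add: pr_R01_def)
    fix V assume V: "openin (body X) V"
    note pl = pull_pr_R01[OF V]
    show "pull ?c V \<in> extensional (fns X V)"
      using V by (simp add: pr_R01_def)
    show "pull ?c V F \<in> fns T (preim T ?c V)" if F: "F \<in> fns X V" for F
      unfolding pl[OF F] p[OF V] by (rule fns[OF V F])
    show "pull ?c V (const_sec X V r) = const_sec T (preim T ?c V) r" for r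
      unfolding pl[OF sm_const[OF X V]] p[OF V] T ..
    show "pull ?c V (invol_sec F) = invol_sec (pull ?c V F)" if F: "F \<in> fns X V" for F
      unfolding pl[OF F] by (rule pl[OF sm_invol[OF X V F]])
    show "pull ?c V (\<lambda>i x. F i x + H i x) = (\<lambda>i x. pull ?c V F i x + pull ?c V H i x)"
      if F: "F \<in> fns X V" and H: "H \<in> fns X V" for F H
      unfolding pl[OF F] pl[OF H] by (rule pl[OF sm_add[OF X V F H]])
    show "pull ?c V (\<lambda>i x. F i x * H i x) = (\<lambda>i x. pull ?c V F i x * pull ?c V H i x)"
      if F: "F \<in> fns X V" and H: "H \<in> fns X V" for F H
      unfolding pl[OF F] pl[OF H] by (rule pl[OF sm_mult[OF X V F H]])
    show "pull ?c W (restr W F) = restr (preim T ?c W) (pull ?c V F)"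
      if W: "openin (body X) W" "W \<subseteq> V" and F: "F \<in> fns X V" for W F
      unfolding pl[OF F] p[OF W(1)] by (rule pull_pr_R01[OF W(1) sm_restr[OF X V W F]])
    show "value_at T (pull ?c V F) x = value_at X F (mmap ?c x)"
      if F: "F \<in> fns X V" and x: "x \<in> preim T ?c V" for F x
      using x T(1) by (simp add: pl[OF F] T mmap_pr_R01 preim_def)
  qed
  show "pr_R01 X \<in> Mor X X" by (rule *) auto
  show "pr_R01 X \<in> Mor (times_R01 X) X"
    by (rule *) (auto intro: times_R01_incl[OF X])
qed

lemma mcomp_id:
  assumes Y: "supermanifold Y" and \<phi>: "\<phi> \<in> Mor X Y"
  shows "mcomp X Y Y (pr_R01 Y) \<phi> = \<phi>"
proof (rule Mor_eqI[OF mcomp_in_Mor[OF Y \<phi> pr_R01_in_Mor(1)[OF Y]] \<phi>])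
  show "mmap (mcomp X Y Y (pr_R01 Y) \<phi>) x = mmap \<phi> x" if "x \<in> points X" for x
    using that by (simp add: mmap_mcomp mmap_pr_R01 Mor_point[OF \<phi>])
  show "pull (mcomp X Y Y (pr_R01 Y) \<phi>) V F = pull \<phi> V F"
    if "openin (body Y) V" "F \<in> fns Y V" for V F
    using that by (simp add: pull_mcomp pull_pr_R01 preim_pr_R01)
qed

section \<open>Odd deformations of morphisms\<close>

context
  fixes X k D
  assumes D: "D \<in> vfields X k"
begin

lemma vfields_nonopen: "\<not> openin (body X) U \<Longrightarrow> D U = (\<lambda>_. undefined)"
  using D unfolding vfields_def by simp

context
  fixes U
  assumes U: "openin (body X) U"
begin

lemma vfields_ext: "D U \<in> fns X U \<rightarrow>\<^sub>E fns X U"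
  and vfields_const: "D U (const_sec X U r) = (\<lambda>i x. 0)"
  and vfields_invol: "F \<in> fns X U \<Longrightarrow>
    D U (invol_sec F) = (\<lambda>i x. (- 1) ^ k * invol_sec (D U F) i x)"
  and vfields_add: "F \<in> fns X U \<Longrightarrow> H \<in> fns X U \<Longrightarrow>
    D U (\<lambda>i x. F i x + H i x) = (\<lambda>i x. D U F i x + D U H i x)"
  and vfields_mult: "F \<in> fns X U \<Longrightarrow> H \<in> fns X U \<Longrightarrow>
    D U (\<lambda>i x. F i x * H i x) =
      (\<lambda>i x. D U F i x * H i x + (invol_sec ^^ k) F i x * D U H i x)"
  and vfields_restr: "openin (body X) W \<Longrightarrow> W \<subseteq> U \<Longrightarrow> F \<in> fns X U \<Longrightarrow>
    D W (restr W F) = restr W (D U F)"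
proof -
  note a = D[unfolded vfields_def mem_Collect_eq, THEN conjunct2, THEN spec, THEN mp, OF U]
  show "D U \<in> fns X U \<rightarrow>\<^sub>E fns X U" by (rule a[THEN conjunct1])
  note b = a[THEN conjunct2]
  show "D U (const_sec X U r) = (\<lambda>i x. 0)" by (rule b[THEN conjunct1, THEN spec])
  note c = b[THEN conjunct2]
  show "F \<in> fns X U \<Longrightarrow> D U (invol_sec F) = (\<lambda>i x. (- 1) ^ k * invol_sec (D U F) i x)"
    by (rule c[THEN conjunct1, THEN bspec])
  note d = c[THEN conjunct2]
  show "F \<in> fns X U \<Longrightarrow> H \<in> fns X U \<Longrightarrow>
    D U (\<lambda>i x. F i x + H i x) = (\<lambda>i x. D U F i x + D U H i x)"
    by (rule d[THEN conjunct1, THEN bspec, THEN bspec, THEN conjunct1])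
  show "F \<in> fns X U \<Longrightarrow> H \<in> fns X U \<Longrightarrow>
    D U (\<lambda>i x. F i x * H i x) =
      (\<lambda>i x. D U F i x * H i x + (invol_sec ^^ k) F i x * D U H i x)"
    by (rule d[THEN conjunct1, THEN bspec, THEN bspec, THEN conjunct2])
  show "openin (body X) W \<Longrightarrow> W \<subseteq> U \<Longrightarrow> F \<in> fns X U \<Longrightarrow> D W (restr W F) = restr W (D U F)"
    by (rule d[THEN conjunct2, rule_format]) simp_all
qed

lemma vfields_fns: "F \<in> fns X U \<Longrightarrow> D U F \<in> fns X U"
  using vfields_ext by (rule PiE_mem)

end

end

lemma vfields_eqI:
  assumes D: "D \<in> vfields X k" and E: "E \<in> vfields X l"
    and eq: "\<And>U F. openin (body X) U \<Longrightarrow> F \<in> fns X U \<Longrightarrow> D U F = E U F"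
  shows "D = E"
proof
  fix U
  show "D U = E U"
  proof (cases "openin (body X) U")
    case True
    have "D U \<in> extensional (fns X U)" "E U \<in> extensional (fns X U)"
      using vfields_ext[OF D True] vfields_ext[OF E True] by (simp_all add: PiE_def)
    then show ?thesis using eq[OF True] by (rule extensionalityI)
  next
    case False
    then show ?thesis by (simp add: vfields_nonopen[OF D] vfields_nonopen[OF E])
  qed
qed

text \<open>\<open>s\<^sup>* + \<epsilon> s\<^sup>*\<circ>E\<close>, the displacement of \<open>s : X \<times> \<real>\<^bsup>0|1\<^esup> \<rightarrow> Y\<close> by \<open>\<epsilon>E\<close>.  For \<open>s\<close> constant at the unit
  of a supergroup and \<open>E\<close> left invariant this is the point \<open>1 + \<epsilon>E\<close>.\<close>

definition deform :: "supermfd \<Rightarrow> supermfd \<Rightarrow> mor \<Rightarrow> vfield \<Rightarrow> mor" where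
  "deform X Y s E = \<lparr>mmap = mmap s,
     pull = (\<lambda>V. if openin (body Y) V
       then restrict (\<lambda>F i x. pull s V F i x + gen (odim X) * pull s V (E V F) i x) (fns Y V)
       else (\<lambda>_. undefined))\<rparr>"

lemma mmap_deform [simp]: "mmap (deform X Y s E) = mmap s"
  by (simp add: deform_def)

lemma preim_deform [simp]: "preim Z (deform X Y s E) V = preim Z s V"
  by (simp add: preim_def)

lemma pull_deform: "openin (body Y) V \<Longrightarrow> F \<in> fns Y V \<Longrightarrow>
    pull (deform X Y s E) V F = (\<lambda>i x. pull s V F i x + gen (odim X) * pull s V (E V F) i x)"
  by (simp add: deform_def)

lemma deform_in_Mor:
  assumes X: "supermanifold X" and Y: "supermanifold Y"
    and s: "s \<in> Mor (times_R01 X) Y" and E: "E \<in> vfields Y 1"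
  shows "deform X Y s E \<in> Mor (times_R01 X) Y"
proof (rule MorI)
  let ?T = "times_R01 X" and ?c = "deform X Y s E" and ?n = "odim X"
  have T: "supermanifold ?T" by (rule supermanifold_times_R01[OF X])
  show "mmap ?c \<in> extensional (points ?T)" using Mor_ext[OF s] by simp
  show "continuous_map (body ?T) (body Y) (mmap ?c)" using Mor_cont[OF s] by simp
  show "\<not> openin (body Y) V \<Longrightarrow> pull ?c V = (\<lambda>_. undefined)" for V
    by (simp add: deform_def)
  fix V assume V: "openin (body Y) V"
  have V': "openin (body X) (preim X s V)" using open_preim[OF s V] by simp
  note pl = pull_deform[OF V]
  note Ef = vfields_fns[OF E V]
  show "pull ?c V \<in> extensional (fns Y V)"
    using V by (simp add: deform_def)
  show "pull ?c V F \<in> fns ?T (preim ?T ?c V)" if F: "F \<in> fns Y V" for F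
    unfolding pl[OF F] preim_deform
    by (rule sm_add[OF T open_preim[OF s V] Mor_fns[OF s V F]])
      (use times_R01_gen_mult[OF X V'] Mor_fns[OF s V Ef[OF F]] in simp)
  show "pull ?c V (const_sec Y V r) = const_sec ?T (preim ?T ?c V) r" for r
    unfolding pl[OF sm_const[OF Y V]] preim_deform Mor_const[OF s V] vfields_const[OF E V]
      Mor_zero[OF s V] by simp
  show "pull ?c V (invol_sec F) = invol_sec (pull ?c V F)" if F: "F \<in> fns Y V" for F
  proof -
    have "pull s V (E V (invol_sec F)) = (\<lambda>i x. - invol_sec (pull s V (E V F)) i x)"
    proof -
      have H: "invol_sec (E V F) \<in> fns Y V" by (rule sm_invol[OF Y V Ef[OF F]])
      have "pull s V (\<lambda>i x. - invol_sec (E V F) i x) =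
          (\<lambda>i x. const_sec ?T (preim ?T s V) (- 1) i x * pull s V (invol_sec (E V F)) i x)"
        unfolding const_sec_minus_one_mult[OF Y V H, symmetric]
        by (subst Mor_mult[OF s V sm_const[OF Y V] H]) (simp add: Mor_const[OF s V])
      also have "\<dots> = (\<lambda>i x. - pull s V (invol_sec (E V F)) i x)"
        using const_sec_minus_one_mult[OF T open_preim[OF s V] Mor_fns[OF s V H]] by simp
      finally show ?thesis
        by (simp add: vfields_invol[OF E V F] Mor_invol[OF s V Ef[OF F]])
    qed
    then show ?thesis
      unfolding pl[OF F] pl[OF sm_invol[OF Y V F]] Mor_invol[OF s V F]
      by (simp add: invol_sec_def)
  qed
  show "pull ?c V (\<lambda>i x. F i x + H i x) = (\<lambda>i x. pull ?c V F i x + pull ?c V H i x)"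
    if F: "F \<in> fns Y V" and H: "H \<in> fns Y V" for F H
    unfolding pl[OF F] pl[OF H] pl[OF sm_add[OF Y V F H]] Mor_add[OF s V F H]
      vfields_add[OF E V F H] Mor_add[OF s V Ef[OF F] Ef[OF H]]
    by (simp add: algebra_simps)
  show "pull ?c V (\<lambda>i x. F i x * H i x) = (\<lambda>i x. pull ?c V F i x * pull ?c V H i x)"
    if F: "F \<in> fns Y V" and H: "H \<in> fns Y V" for F H
  proof -
    have "pull s V (E V (\<lambda>i x. F i x * H i x)) = (\<lambda>i x.
        pull s V (E V F) i x * pull s V H i x + ginvol (pull s V F i x) * pull s V (E V H) i x)"
    proof -
      have *: "E V (\<lambda>i x. F i x * H i x) = (\<lambda>i x. E V F i x * H i x + invol_sec F i x * E V H i x)"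
        using vfields_mult[OF E V F H] by simp
      show ?thesis
        unfolding *
        by (simp add: Mor_add[OF s V sm_mult[OF Y V Ef[OF F] H] sm_mult[OF Y V sm_invol[OF Y V F] Ef[OF H]]]
            Mor_mult[OF s V Ef[OF F] H] Mor_mult[OF s V sm_invol[OF Y V F] Ef[OF H]]
            Mor_invol[OF s V F] invol_sec_def[of "pull s V F"])
    qed
    then show ?thesis
      unfolding pl[OF F] pl[OF H] pl[OF sm_mult[OF Y V F H]] Mor_mult[OF s V F H] gen_dual_mult
      by simp
  qed
  show "pull ?c W (restr W F) = restr (preim ?T ?c W) (pull ?c V F)"
    if W: "openin (body Y) W" "W \<subseteq> V" and F: "F \<in> fns Y V" for W F
    unfolding pl[OF F] pull_deform[OF W(1) sm_restr[OF Y V W F]] Mor_restr[OF s V W F]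
      vfields_restr[OF E V W F] Mor_restr[OF s V W Ef[OF F]] preim_deform
    by (simp add: restr_def fun_eq_iff)
  show "value_at ?T (pull ?c V F) x = value_at Y F (mmap ?c x)"
    if F: "F \<in> fns Y V" and x: "x \<in> preim ?T ?c V" for F x
  proof -
    have "value_at ?T (pull s V F) x = value_at Y F (mmap s x)"
      using Mor_value[OF s V F] x unfolding preim_deform by blast
    then show ?thesis unfolding pl[OF F] by (simp add: value_at_def)
  qed
qed

lemma mcomp_deform:
  assumes X: "supermanifold X" and Y: "supermanifold Y" and Z: "supermanifold Z"
    and s: "s \<in> Mor (times_R01 X) Y" and E: "E \<in> vfields Y 1" and \<phi>: "\<phi> \<in> Mor Y Z"
    and D: "\<And>V F. openin (body Z) V \<Longrightarrow> F \<in> fns Z V \<Longrightarrow> D V F \<in> fns Z V"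
    and related: "\<And>V F. openin (body Z) V \<Longrightarrow> F \<in> fns Z V \<Longrightarrow>
      E (preim Y \<phi> V) (pull \<phi> V F) = pull \<phi> V (D V F)"
  shows "mcomp (times_R01 X) Y Z \<phi> (deform X Y s E) = deform X Z (mcomp (times_R01 X) Y Z \<phi> s) D"
proof (rule mor.equality)
  let ?l = "mcomp (times_R01 X) Y Z \<phi> (deform X Y s E)"
    and ?r = "deform X Z (mcomp (times_R01 X) Y Z \<phi> s) D"
  show "mmap ?l = mmap ?r" by (simp add: mcomp_def)
  show "pull ?l = pull ?r"
  proof (rule ext, rule ext)
    fix V F
    consider "\<not> openin (body Z) V" | "openin (body Z) V" "F \<notin> fns Z V"
      | "openin (body Z) V" "F \<in> fns Z V" by blast
    then show "pull ?l V F = pull ?r V F"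
    proof cases
      case 3
      note V = 3(1) and F = 3(2)
      show ?thesis
        unfolding pull_mcomp[OF V F] pull_deform[OF V F] pull_mcomp[OF V D[OF V F]]
          pull_deform[OF open_preim[OF \<phi> V] Mor_fns[OF \<phi> V F]] related[OF V F] ..
    qed (simp_all add: mcomp_def deform_def)
  qed
qed simp

lemma deform_zero:
  assumes s: "s \<in> Mor S Y"
  shows "deform X Y s (\<lambda>V F i x. 0) = s"
proof (rule mor.equality)
  show "pull (deform X Y s (\<lambda>V F i x. 0)) = pull s"
  proof (rule ext, rule ext)
    fix V F
    consider "\<not> openin (body Y) V" | "openin (body Y) V" "F \<notin> fns Y V"
      | "openin (body Y) V" "F \<in> fns Y V" by blast
    then show "pull (deform X Y s (\<lambda>V F i x. 0)) V F = pull s V F"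
    proof cases
      case 1
      then show ?thesis by (simp add: deform_def Mor_nonopen[OF s])
    next
      case 2
      then show ?thesis using PiE_arb[OF Mor_pull_ext[OF s 2(1)] 2(2)] by (simp add: deform_def)
    next
      case 3
      then show ?thesis by (simp add: pull_deform Mor_zero[OF s])
    qed
  qed
qed simp_all

lemma odd_shift_eq_deform:
  assumes "D \<in> vfields X 1"
  shows "odd_shift X D = deform X X (pr_R01 X) D"
proof (rule mor.equality)
  show "pull (odd_shift X D) = pull (deform X X (pr_R01 X) D)"
  proof (rule ext, rule ext)
    fix V F
    show "pull (odd_shift X D) V F = pull (deform X X (pr_R01 X) D) V F"
    proof (cases "openin (body X) V \<and> F \<in> fns X V")
      case True
      then show ?thesis
        by (simp add: odd_shift_def pull_deform pull_pr_R01 vfields_fns[OF assms])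
    qed (auto simp: odd_shift_def deform_def)
  qed
qed (simp_all add: odd_shift_def pr_R01_def)

section \<open>Evaluation at a point\<close>

text \<open>The map \<open>X \<times> \<real>\<^bsup>0|1\<^esup> \<rightarrow> Y \<times> \<real>\<^bsup>0|1\<^esup>\<close> which is the identity on the odd line and constant at \<open>z\<close> on \<open>X\<close>;
  \<open>i\<close> is the index of a chart around \<open>z\<close>.\<close>

definition point_mor :: "supermfd \<Rightarrow> supermfd \<Rightarrow> nat \<Rightarrow> pt \<Rightarrow> mor" where
  "point_mor X Y i z = \<lparr>mmap = restrict (\<lambda>_. z) (points X),
     pull = (\<lambda>V. if openin (body Y) V
       then restrict (\<lambda>F k t. const_sec X (if z \<in> V then points X else {}) (coeff (F i z) {}) k t +
           gen (odim X) * const_sec X (if z \<in> V then points X else {}) (coeff (F i z) {odim Y}) k t)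
         (fns (times_R01 Y) V)
       else (\<lambda>_. undefined))\<rparr>"

lemma mmap_point_mor: "x \<in> points X \<Longrightarrow> mmap (point_mor X Y i z) x = z"
  by (simp add: point_mor_def)

lemma preim_point_mor: "preim X (point_mor X Y i z) V = (if z \<in> V then points X else {})"
  by (auto simp: preim_def mmap_point_mor)

lemma pull_point_mor: "openin (body Y) V \<Longrightarrow> F \<in> fns (times_R01 Y) V \<Longrightarrow>
    pull (point_mor X Y i z) V F =
      (\<lambda>k t. const_sec X (preim X (point_mor X Y i z) V) (coeff (F i z) {}) k t +
        gen (odim X) * const_sec X (preim X (point_mor X Y i z) V) (coeff (F i z) {odim Y}) k t)"
  unfolding preim_point_mor by (simp add: point_mor_def)

lemma const_sec_arith:
  "const_sec X U (r + r') i x = const_sec X U r i x + const_sec X U r' i x"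
  "const_sec X U (r * r') i x = const_sec X U r i x * const_sec X U r' i x"
  "const_sec X U (- r) i x = - const_sec X U r i x"
  "ginvol (const_sec X U r i x) = const_sec X U r i x"
  by (simp_all add: const_sec_def)

lemma coeff_ginvol_sing: "coeff (ginvol a) {n} = - coeff a {n}"
  by (simp add: coeff_ginvol)

lemma coeff_last_fns: "supermanifold X \<Longrightarrow> openin (body X) U \<Longrightarrow> F \<in> fns X U \<Longrightarrow>
    coeff (F i x) {odim X} = 0"
  using sm_grass[of X U F i x] by (auto intro: coeff_grass)

context
  fixes X Y i z
  assumes X: "supermanifold X" and Y: "supermanifold Y" and z: "z \<in> cdom Y i"
begin

lemma point_mor_in_Mor: "point_mor X Y i z \<in> Mor (times_R01 X) (times_R01 Y)"
proof (rule MorI)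
  let ?S = "times_R01 X" and ?T = "times_R01 Y" and ?c = "point_mor X Y i z" and ?n = "odim X"
  have T: "supermanifold ?T" by (rule supermanifold_times_R01[OF Y])
  have op: "openin (body X) (preim X ?c V)" for V unfolding preim_point_mor by simp
  show "mmap ?c \<in> extensional (points ?S)" by (simp add: point_mor_def)
  have "continuous_map (body X) (body Y) (\<lambda>_. z)" using cdom_points[OF Y z] by simp
  then show "continuous_map (body ?S) (body ?T) (mmap ?c)"
    unfolding times_R01_simps by (rule continuous_map_eq) (simp add: mmap_point_mor)
  show "\<not> openin (body ?T) V \<Longrightarrow> pull ?c V = (\<lambda>_. undefined)" for V
    by (simp add: point_mor_def)
  fix V assume VT: "openin (body ?T) V"
  then have V: "openin (body Y) V" by simp
  note pl = pull_point_mor[OF V]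
  show "pull ?c V \<in> extensional (fns ?T V)"
    using V by (simp add: point_mor_def)
  show "pull ?c V F \<in> fns ?S (preim ?S ?c V)" if F: "F \<in> fns ?T V" for F
    unfolding pl[OF F] times_R01_derived
    by (rule fns_times_R01I[OF sm_const[OF X op] sm_const[OF X op]])
  show "pull ?c V (const_sec ?T V r) = const_sec ?S (preim ?S ?c V) r" for r
  proof (cases "z \<in> V")
    case True
    then have "const_sec Y V r i z = of_real r" using z by (simp add: const_sec_def)
    then show ?thesis
      unfolding pl[OF sm_const[OF T VT]] by (simp add: coeff_of_real const_sec_zero)
  next
    case False
    then have "preim X ?c V = {}" by (simp add: preim_point_mor)
    then show ?thesis
      unfolding pl[OF sm_const[OF T VT]] by (simp add: const_sec_empty)
  qed
  show "pull ?c V (invol_sec F) = invol_sec (pull ?c V F)" if F: "F \<in> fns ?T V" for F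
    unfolding pl[OF F] pl[OF sm_invol[OF T VT F]]
    by (simp add: invol_sec_def coeff_ginvol_sing const_sec_arith)
  show "pull ?c V (\<lambda>i x. F i x + H i x) = (\<lambda>i x. pull ?c V F i x + pull ?c V H i x)"
    if F: "F \<in> fns ?T V" and H: "H \<in> fns ?T V" for F H
    unfolding pl[OF F] pl[OF H] pl[OF sm_add[OF T VT F H]]
    by (simp add: const_sec_arith algebra_simps)
  show "pull ?c V (\<lambda>i x. F i x * H i x) = (\<lambda>i x. pull ?c V F i x * pull ?c V H i x)"
    if F: "F \<in> fns ?T V" and H: "H \<in> fns ?T V" for F H
    unfolding pl[OF F] pl[OF H] pl[OF sm_mult[OF T VT F H]] coeff_mult_empty coeff_mult_sing
      gen_dual_mult const_sec_arith by (simp add: add.commute)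
  show "pull ?c W (restr W F) = restr (preim ?S ?c W) (pull ?c V F)"
    if W: "openin (body ?T) W" "W \<subseteq> V" and F: "F \<in> fns ?T V" for W F
  proof (cases "z \<in> W")
    case True
    have "openin (body Y) W" using W by simp
    from pull_point_mor[OF this sm_restr[OF T VT W F]] True W(2) show ?thesis
      unfolding pl[OF F] times_R01_derived
      by (auto simp: preim_point_mor restr_def const_sec_def fun_eq_iff)
  next
    case False
    have "openin (body Y) W" using W by simp
    from pull_point_mor[OF this sm_restr[OF T VT W F]] False show ?thesis
      by (simp add: preim_point_mor restr_def const_sec_empty)
  qed
  show "value_at ?S (pull ?c V F) x = value_at ?T F (mmap ?c x)"
    if F: "F \<in> fns ?T V" and x: "x \<in> preim ?S ?c V" for F x
  proof -
    have x': "x \<in> points X" "x \<in> preim X ?c V" "z \<in> V"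
      using x by (auto simp: preim_point_mor split: if_splits)
    have "value_at X (pull ?c V F) x = value_at X (const_sec X (preim X ?c V) (coeff (F i z) {})) x"
      unfolding pl[OF F] by (simp add: value_at_def)
    also have "\<dots> = coeff (F i z) {}" by (rule value_at_const_sec[OF X op x'(2)])
    also have "\<dots> = value_at ?T F z" using value_at_chart[OF T VT F x'(3), of i] z by simp
    finally show ?thesis using x' by (simp add: mmap_point_mor)
  qed
qed

lemma mcomp_point_mor_eq_const:
  assumes \<phi>: "\<phi> \<in> Mor (times_R01 Y) Y" and fixed: "mmap \<phi> z = z"
    and odd: "\<And>V F. openin (body Y) V \<Longrightarrow> F \<in> fns Y V \<Longrightarrow> z \<in> V \<Longrightarrow> coeff (pull \<phi> V F i z) {odim Y} = 0"
  shows "mcomp (times_R01 X) (times_R01 Y) Y \<phi> (point_mor X Y i z) = const_mor (times_R01 X) Y z"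
proof (rule Mor_eqI)
  let ?S = "times_R01 X" and ?T = "times_R01 Y" and ?c = "point_mor X Y i z"
  have S: "supermanifold ?S" and T: "supermanifold ?T"
    by (rule supermanifold_times_R01[OF X], rule supermanifold_times_R01[OF Y])
  show "mcomp ?S ?T Y \<phi> ?c \<in> Mor ?S Y" by (rule mcomp_in_Mor[OF Y point_mor_in_Mor \<phi>])
  show "const_mor ?S Y z \<in> Mor ?S Y" by (rule const_mor_in_Mor[OF S Y cdom_points[OF Y z]])
  show "x \<in> points ?S \<Longrightarrow> mmap (mcomp ?S ?T Y \<phi> ?c) x = mmap (const_mor ?S Y z) x" for x
    by (simp add: mmap_mcomp mmap_const_mor mmap_point_mor fixed)
  show "pull (mcomp ?S ?T Y \<phi> ?c) V F = pull (const_mor ?S Y z) V F"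
    if V: "openin (body Y) V" and F: "F \<in> fns Y V" for V F
  proof -
    have iff: "z \<in> preim ?T \<phi> V \<longleftrightarrow> z \<in> V" using cdom_points[OF Y z] fixed by (simp add: preim_def)
    have op: "openin (body Y) (preim ?T \<phi> V)" using open_preim[OF \<phi> V] by simp
    have pm: "preim X ?c (preim ?T \<phi> V) = (if z \<in> V then points X else {})"
      unfolding preim_point_mor iff ..
    show ?thesis
    proof (cases "z \<in> V")
      case True
      have "coeff (pull \<phi> V F i z) {} = value_at ?T (pull \<phi> V F) z"
        using value_at_chart[OF T open_preim[OF \<phi> V] Mor_fns[OF \<phi> V F], of z i] iff True z by simp
      also have "\<dots> = value_at Y F z" using Mor_value[OF \<phi> V F, of z] iff True fixed by simp
      finally show ?thesis
        unfolding pull_mcomp[OF V F] pull_const_mor[OF V F] pull_point_mor[OF op Mor_fns[OF \<phi> V F]] pm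
        using odd[OF V F True] by (simp add: const_sec_zero)
    next
      case False
      then show ?thesis
        unfolding pull_mcomp[OF V F] pull_const_mor[OF V F] pull_point_mor[OF op Mor_fns[OF \<phi> V F]] pm
        by (simp add: const_sec_empty)
    qed
  qed
qed

lemma pr_R01_point_mor:
  "mcomp (times_R01 X) (times_R01 Y) Y (pr_R01 Y) (point_mor X Y i z) = const_mor (times_R01 X) Y z"
  by (rule mcomp_point_mor_eq_const[OF pr_R01_in_Mor(2)[OF Y]])
    (simp_all add: mmap_pr_R01 cdom_points[OF Y z] pull_pr_R01 coeff_last_fns[OF Y])

lemma odd_shift_point_mor:
  assumes D: "D \<in> vfields Y 1"
    and vanish: "\<And>V F. openin (body Y) V \<Longrightarrow> F \<in> fns Y V \<Longrightarrow> coeff (D V F i z) {} = 0"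
  shows "mcomp (times_R01 X) (times_R01 Y) Y (odd_shift Y D) (point_mor X Y i z) =
    const_mor (times_R01 X) Y z"
  unfolding odd_shift_eq_deform[OF D]
proof (rule mcomp_point_mor_eq_const[OF deform_in_Mor[OF Y Y pr_R01_in_Mor(2)[OF Y] D]])
  show "mmap (deform Y Y (pr_R01 Y) D) z = z" by (simp add: mmap_pr_R01 cdom_points[OF Y z])
  show "coeff (pull (deform Y Y (pr_R01 Y) D) V F i z) {odim Y} = 0"
    if "openin (body Y) V" "F \<in> fns Y V" for V F
    using that
    by (simp add: pull_deform pull_pr_R01 vfields_fns[OF D] coeff_last_fns[OF Y] vanish)
qed

end

section \<open>Lie supergroups\<close>

lemma const_mor_times_R01 [simp]: "const_mor (times_R01 X) = const_mor X"
  by (simp add: const_mor_def fun_eq_iff)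

lemma left_invariant_vfields: "D \<in> left_invariant G k \<Longrightarrow> D \<in> vfields (gmfd G) k"
  by (simp add: left_invariant_def)

definition rtrans :: "lie_sgroup \<Rightarrow> pt \<Rightarrow> mor" where
  "rtrans G h = pmult G (gmfd G) (pr_R01 (gmfd G)) (const_mor (gmfd G) (gmfd G) h)"

context
  fixes G :: lie_sgroup
  assumes G: "lie_supergroup G"
begin

lemma group_sm: "supermanifold (gmfd G)" "supermanifold (gsq G)"
  and gmult_in_Mor: "gmult G \<in> Mor (gsq G) (gmfd G)"
  and ginv_in_Mor: "ginv G \<in> Mor (gmfd G) (gmfd G)"
  and gpr_in_Mor: "gpr1 G \<in> Mor (gsq G) (gmfd G)" "gpr2 G \<in> Mor (gsq G) (gmfd G)"
  and gunit_point: "gunit G \<in> points (gmfd G)"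
  and prod_ex1: "supermanifold S \<Longrightarrow> f \<in> Mor S (gmfd G) \<Longrightarrow> h \<in> Mor S (gmfd G) \<Longrightarrow>
    \<exists>!k. k \<in> Mor S (gsq G) \<and> mcomp S (gsq G) (gmfd G) (gpr1 G) k = f \<and>
      mcomp S (gsq G) (gmfd G) (gpr2 G) k = h"
  using G unfolding lie_supergroup_def is_product_def by blast+

lemma pmult_assoc: "supermanifold S \<Longrightarrow> f \<in> Mor S (gmfd G) \<Longrightarrow> h \<in> Mor S (gmfd G) \<Longrightarrow>
    k \<in> Mor S (gmfd G) \<Longrightarrow> pmult G S (pmult G S f h) k = pmult G S f (pmult G S h k)"
  and pmult_pone: "supermanifold S \<Longrightarrow> f \<in> Mor S (gmfd G) \<Longrightarrow> pmult G S f (pone G S) = f"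
  and pinv_pmult: "supermanifold S \<Longrightarrow> f \<in> Mor S (gmfd G) \<Longrightarrow>
    pmult G S (pinv G S f) f = pone G S"
  and pmult_pinv: "supermanifold S \<Longrightarrow> f \<in> Mor S (gmfd G) \<Longrightarrow>
    pmult G S f (pinv G S f) = pone G S"
  using G unfolding lie_supergroup_def by blast+

lemma pinv_in_Mor: "f \<in> Mor S (gmfd G) \<Longrightarrow> pinv G S f \<in> Mor S (gmfd G)"
  unfolding pinv_def by (rule mcomp_in_Mor[OF group_sm(1) _ ginv_in_Mor])

context
  fixes S
  assumes S: "supermanifold S"
begin

lemma pone_in_Mor: "pone G S \<in> Mor S (gmfd G)"
  unfolding pone_def by (rule const_mor_in_Mor[OF S group_sm(1) gunit_point])

context
  fixes f h
  assumes f: "f \<in> Mor S (gmfd G)" and h: "h \<in> Mor S (gmfd G)"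
begin

lemma pair_mor: "pair_mor G S f h \<in> Mor S (gsq G)"
    "mcomp S (gsq G) (gmfd G) (gpr1 G) (pair_mor G S f h) = f"
    "mcomp S (gsq G) (gmfd G) (gpr2 G) (pair_mor G S f h) = h"
proof -
  note a = theI'[OF prod_ex1[OF S f h], folded pair_mor_def]
  show "pair_mor G S f h \<in> Mor S (gsq G)" by (rule a[THEN conjunct1])
  show "mcomp S (gsq G) (gmfd G) (gpr1 G) (pair_mor G S f h) = f"
    by (rule a[THEN conjunct2, THEN conjunct1])
  show "mcomp S (gsq G) (gmfd G) (gpr2 G) (pair_mor G S f h) = h"
    by (rule a[THEN conjunct2, THEN conjunct2])
qed

lemma pair_mor_unique:
  assumes "k \<in> Mor S (gsq G)" "mcomp S (gsq G) (gmfd G) (gpr1 G) k = f"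
    "mcomp S (gsq G) (gmfd G) (gpr2 G) k = h"
  shows "pair_mor G S f h = k"
  unfolding pair_mor_def using assms by (intro the1_equality[OF prod_ex1[OF S f h]] conjI)

lemma pmult_in_Mor: "pmult G S f h \<in> Mor S (gmfd G)"
  unfolding pmult_def by (rule mcomp_in_Mor[OF group_sm(1) pair_mor(1) gmult_in_Mor])

lemma pmult_mcomp:
  assumes R: "supermanifold R" and j: "j \<in> Mor R S"
  shows "mcomp R S (gmfd G) (pmult G S f h) j =
    pmult G R (mcomp R S (gmfd G) f j) (mcomp R S (gmfd G) h j)"
proof -
  note Gm = group_sm
  let ?k = "mcomp R S (gsq G) (pair_mor G S f h) j"
  have k: "?k \<in> Mor R (gsq G)" by (rule mcomp_in_Mor[OF Gm(2) j pair_mor(1)])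
  have "pair_mor G R (mcomp R S (gmfd G) f j) (mcomp R S (gmfd G) h j) = ?k"
  proof (rule the1_equality[OF prod_ex1[OF R mcomp_in_Mor[OF Gm(1) j f] mcomp_in_Mor[OF Gm(1) j h]],
        folded pair_mor_def], intro conjI)
    show "mcomp R (gsq G) (gmfd G) (gpr1 G) ?k = mcomp R S (gmfd G) f j"
      unfolding mcomp_assoc[OF Gm(2) Gm(1) j pair_mor(1) gpr_in_Mor(1)] pair_mor(2) ..
    show "mcomp R (gsq G) (gmfd G) (gpr2 G) ?k = mcomp R S (gmfd G) h j"
      unfolding mcomp_assoc[OF Gm(2) Gm(1) j pair_mor(1) gpr_in_Mor(2)] pair_mor(3) ..
  qed (rule k)
  then show ?thesis
    unfolding pmult_def by (simp add: mcomp_assoc[OF Gm(2) Gm(1) j pair_mor(1) gmult_in_Mor])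
qed

end

end

text \<open>The pair \<open>(f, 1 + \<epsilon>D)\<close> is the displacement of \<open>(f, 1)\<close> by \<open>\<epsilon>(1 \<otimes> D)\<close>, since both have the same
  components, and \<open>1 \<otimes> D\<close> is related to \<open>D\<close> under the multiplication.\<close>

lemma pmult_deform_pone:
  assumes X: "supermanifold X" and f: "f \<in> Mor (times_R01 X) (gmfd G)"
    and D: "D \<in> left_invariant G 1"
  defines "T \<equiv> times_R01 X"
  shows "deform X (gmfd G) (pone G T) D \<in> Mor T (gmfd G)"
    and "pmult G T f (deform X (gmfd G) (pone G T) D) = deform X (gmfd G) f D"
proof -
  note Gm = group_sm
  have T: "supermanifold T" unfolding T_def by (rule supermanifold_times_R01[OF X])
  have f': "f \<in> Mor T (gmfd G)" using f by (simp add: T_def)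
  have Dv: "D \<in> vfields (gmfd G) 1" using D by (rule left_invariant_vfields)
  show one: "deform X (gmfd G) (pone G T) D \<in> Mor T (gmfd G)"
    unfolding T_def
    by (rule deform_in_Mor[OF X Gm(1) _ Dv]) (rule pone_in_Mor[OF supermanifold_times_R01[OF X]])
  obtain E where E: "E \<in> vfields (gsq G) 1"
    and rel: "\<And>V F. openin (body (gmfd G)) V \<Longrightarrow> F \<in> fns (gmfd G) V \<Longrightarrow>
       E (preim (gsq G) (gpr1 G) V) (pull (gpr1 G) V F) = (\<lambda>i x. 0) \<and>
       E (preim (gsq G) (gpr2 G) V) (pull (gpr2 G) V F) = pull (gpr2 G) V (D V F) \<and>
       E (preim (gsq G) (gmult G) V) (pull (gmult G) V F) = pull (gmult G) V (D V F)"
    using D unfolding left_invariant_def by blast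
  define s where "s = pair_mor G T f (pone G T)"
  note pm = pair_mor[OF T f' pone_in_Mor[OF T], folded s_def]
  have s: "s \<in> Mor (times_R01 X) (gsq G)" using pm(1) by (simp add: T_def)
  let ?k = "deform X (gsq G) s E"
  have k: "?k \<in> Mor T (gsq G)" unfolding T_def by (rule deform_in_Mor[OF X Gm(2) s E])
  have "mcomp T (gsq G) (gmfd G) (gpr1 G) ?k = f"
  proof -
    have "mcomp T (gsq G) (gmfd G) (gpr1 G) ?k =
        deform X (gmfd G) (mcomp T (gsq G) (gmfd G) (gpr1 G) s) (\<lambda>V F i x. 0)"
      unfolding T_def
      by (rule mcomp_deform[OF X Gm(2) Gm(1) s E gpr_in_Mor(1)])
        (simp_all add: sm_zero[OF Gm(1)] rel Mor_zero[OF gpr_in_Mor(1)])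
    then show ?thesis unfolding pm(2) deform_zero[OF f'] .
  qed
  moreover have "mcomp T (gsq G) (gmfd G) (gpr2 G) ?k = deform X (gmfd G) (pone G T) D"
  proof -
    have "mcomp T (gsq G) (gmfd G) (gpr2 G) ?k =
        deform X (gmfd G) (mcomp T (gsq G) (gmfd G) (gpr2 G) s) D"
      unfolding T_def
      by (rule mcomp_deform[OF X Gm(2) Gm(1) s E gpr_in_Mor(2)]) (simp_all add: vfields_fns[OF Dv] rel)
    then show ?thesis unfolding pm(3) .
  qed
  ultimately have "pmult G T f (deform X (gmfd G) (pone G T) D) =
      mcomp T (gsq G) (gmfd G) (gmult G) ?k"
    unfolding pmult_def using pair_mor_unique[OF T f' one k] by simp
  also have "\<dots> = deform X (gmfd G) (mcomp T (gsq G) (gmfd G) (gmult G) s) D"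
    unfolding T_def
    by (rule mcomp_deform[OF X Gm(2) Gm(1) s E gmult_in_Mor]) (simp_all add: vfields_fns[OF Dv] rel)
  also have "mcomp T (gsq G) (gmfd G) (gmult G) s = pmult G T f (pone G T)"
    by (simp add: pmult_def s_def)
  also have "\<dots> = f" by (rule pmult_pone[OF T f'])
  finally show "pmult G T f (deform X (gmfd G) (pone G T) D) = deform X (gmfd G) f D" .
qed

lemma left_invariant_zero:
  assumes D: "D \<in> left_invariant G 1"
    and triv: "deform (gmfd G) (gmfd G) (pone G (times_R01 (gmfd G))) D = pone G (times_R01 (gmfd G))"
    and V: "openin (body (gmfd G)) V" and F: "F \<in> fns (gmfd G) V"
  shows "D V F = (\<lambda>i x. 0)"
proof -
  note X = group_sm(1)
  let ?X = "gmfd G" and ?T = "times_R01 (gmfd G)"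
  have T: "supermanifold ?T" by (rule supermanifold_times_R01[OF X])
  have x: "pr_R01 ?X \<in> Mor ?T ?X" by (rule pr_R01_in_Mor[OF X])
  have DF: "D V F \<in> fns ?X V" by (rule vfields_fns[OF left_invariant_vfields[OF D] V F])
  have "deform ?X ?X (pr_R01 ?X) D = pr_R01 ?X"
    using pmult_deform_pone(2)[OF X x D] unfolding triv pmult_pone[OF T x] by simp
  then have "pull (deform ?X ?X (pr_R01 ?X) D) V F = F"
    by (simp add: pull_pr_R01[OF V F])
  then have "(\<lambda>i x. F i x + gen (odim ?X) * D V F i x) = (\<lambda>i x. F i x + gen (odim ?X) * 0)"
    unfolding pull_deform[OF V F] pull_pr_R01[OF V F] pull_pr_R01[OF V DF] by simp
  then show ?thesis
    by (rule times_R01_eqD(2)[OF X V F DF F sm_zero[OF X V]])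
qed

context
  fixes h
  assumes h: "h \<in> points (gmfd G)"
begin

lemma rtrans_in_Mor: "rtrans G h \<in> Mor (gmfd G) (gmfd G)"
  unfolding rtrans_def
  by (rule pmult_in_Mor[OF group_sm(1) pr_R01_in_Mor(1)[OF group_sm(1)]
      const_mor_in_Mor[OF group_sm(1) group_sm(1) h]])

lemma rtrans_mcomp:
  assumes S: "supermanifold S" and y: "y \<in> Mor S (gmfd G)"
  shows "mcomp S (gmfd G) (gmfd G) (rtrans G h) y = pmult G S y (const_mor S (gmfd G) h)"
  unfolding rtrans_def
    pmult_mcomp[OF group_sm(1) pr_R01_in_Mor(1)[OF group_sm(1)]
      const_mor_in_Mor[OF group_sm(1) group_sm(1) h] S y]
    mcomp_id[OF group_sm(1) y] mcomp_const_mor_left[OF S group_sm(1) group_sm(1) h y] ..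

lemma rtrans_pull_inj:
  assumes V: "openin (body (gmfd G)) V" and F: "F \<in> fns (gmfd G) V"
    and zero: "pull (rtrans G h) V F = (\<lambda>i x. 0)"
  shows "F = (\<lambda>i x. 0)"
proof -
  note X = group_sm(1)
  let ?X = "gmfd G" and ?c = "const_mor (gmfd G) (gmfd G) h" and ?id = "pr_R01 (gmfd G)"
  have c: "?c \<in> Mor ?X ?X" by (rule const_mor_in_Mor[OF X X h])
  have id: "?id \<in> Mor ?X ?X" by (rule pr_R01_in_Mor[OF X])
  have ci: "pinv G ?X ?c \<in> Mor ?X ?X" by (rule pinv_in_Mor[OF c])
  define r where "r = pmult G ?X ?id (pinv G ?X ?c)"
  have r: "r \<in> Mor ?X ?X" unfolding r_def by (rule pmult_in_Mor[OF X id ci])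
  have "mcomp ?X ?X ?X (rtrans G h) r = pmult G ?X r ?c" by (rule rtrans_mcomp[OF X r])
  also have "\<dots> = ?id"
    unfolding r_def pmult_assoc[OF X id ci c] pinv_pmult[OF X c] pmult_pone[OF X id] ..
  finally have "pull r (preim ?X (rtrans G h) V) (pull (rtrans G h) V F) = F"
    using pull_mcomp[OF V F] pull_pr_R01[OF V F] by metis
  then show ?thesis
    unfolding zero Mor_zero[OF r open_preim[OF rtrans_in_Mor V]] by simp
qed

lemma rtrans_intertwines:
  assumes D: "D \<in> left_invariant G 1" and E: "E \<in> left_invariant G 1"
  defines "T \<equiv> times_R01 (gmfd G)"
  assumes eq: "pmult G T (deform (gmfd G) (gmfd G) (pone G T) E) (const_mor T (gmfd G) h) =
      pmult G T (const_mor T (gmfd G) h) (deform (gmfd G) (gmfd G) (pone G T) D)"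
    and V: "openin (body (gmfd G)) V" and F: "F \<in> fns (gmfd G) V"
  shows "pull (rtrans G h) V (D V F) = E (preim (gmfd G) (rtrans G h) V) (pull (rtrans G h) V F)"
proof -
  note X = group_sm(1)
  let ?X = "gmfd G" and ?R = "rtrans G h" and ?x = "pr_R01 (gmfd G)" and ?c = "const_mor T (gmfd G) h"
    and ?U = "preim (gmfd G) (rtrans G h) V"
  have T: "supermanifold T" unfolding T_def by (rule supermanifold_times_R01[OF X])
  have x: "?x \<in> Mor T ?X" unfolding T_def by (rule pr_R01_in_Mor[OF X])
  have c: "?c \<in> Mor T ?X" by (rule const_mor_in_Mor[OF T X h])
  have Dv: "D \<in> vfields ?X 1" and Ev: "E \<in> vfields ?X 1"
    using D E by (simp_all add: left_invariant_vfields)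
  have one: "deform ?X ?X (pone G T) D \<in> Mor T ?X" "deform ?X ?X (pone G T) E \<in> Mor T ?X"
    using pmult_deform_pone(1)[OF X x[unfolded T_def]] D E by (simp_all add: T_def)
  have R: "?R \<in> Mor ?X ?X" by (rule rtrans_in_Mor)
  have xc: "mcomp T ?X ?X ?R ?x \<in> Mor T ?X" by (rule mcomp_in_Mor[OF X x R])
  have xE: "deform ?X ?X ?x E \<in> Mor T ?X"
    unfolding T_def by (rule deform_in_Mor[OF X X x[unfolded T_def] Ev])
  have "mcomp T ?X ?X ?R (deform ?X ?X ?x E) = pmult G T (deform ?X ?X ?x E) ?c"
    by (rule rtrans_mcomp[OF T xE])
  also have "\<dots> = pmult G T (pmult G T ?x (deform ?X ?X (pone G T) E)) ?c"
    using pmult_deform_pone(2)[OF X x[unfolded T_def] E] by (simp add: T_def)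
  also have "\<dots> = pmult G T (pmult G T ?x ?c) (deform ?X ?X (pone G T) D)"
    unfolding pmult_assoc[OF T x one(2) c] eq pmult_assoc[OF T x c one(1)] ..
  also have "\<dots> = pmult G T (mcomp T ?X ?X ?R ?x) (deform ?X ?X (pone G T) D)"
    unfolding rtrans_mcomp[OF T x] ..
  also have "\<dots> = deform ?X ?X (mcomp T ?X ?X ?R ?x) D"
    using pmult_deform_pone(2)[OF X xc[unfolded T_def] D] by (simp add: T_def)
  finally have pl: "pull (mcomp T ?X ?X ?R (deform ?X ?X ?x E)) V F =
      pull (deform ?X ?X (mcomp T ?X ?X ?R ?x) D) V F" by simp
  have U: "openin (body ?X) ?U" by (rule open_preim[OF R V])
  have DF: "D V F \<in> fns ?X V" by (rule vfields_fns[OF Dv V F])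
  have RF: "pull ?R V F \<in> fns ?X ?U" and RDF: "pull ?R V (D V F) \<in> fns ?X ?U"
    by (rule Mor_fns[OF R V F], rule Mor_fns[OF R V DF])
  have ERF: "E ?U (pull ?R V F) \<in> fns ?X ?U" by (rule vfields_fns[OF Ev U RF])
  have "(\<lambda>i z. pull ?R V F i z + gen (odim ?X) * pull ?R V (D V F) i z) =
      (\<lambda>i z. pull ?R V F i z + gen (odim ?X) * E ?U (pull ?R V F) i z)"
    using pl[symmetric]
    unfolding pull_mcomp[OF V F] pull_deform[OF V F] pull_mcomp[OF V DF] pull_deform[OF U RF]
      pull_pr_R01[OF U RF] pull_pr_R01[OF U RDF] pull_pr_R01[OF U ERF] .
  then show ?thesis by (rule times_R01_eqD(2)[OF X U RF RDF RF ERF])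
qed

end

end

section \<open>The Lie superalgebra of a supergroup\<close>

lemma subspace_gparts:
  assumes "lie_superalgebra L"
  shows "subspace (geven L)" "subspace (godd L)" "bilinear (brk L)"
    and "x \<in> godd L \<Longrightarrow> y \<in> godd L \<Longrightarrow> brk L x y \<in> geven L"
proof -
  show "subspace (geven L)" "subspace (godd L)" "bilinear (brk L)"
    using assms by (simp_all add: lie_superalgebra_def)
  have "\<forall>j k. \<forall>x\<in>gpart L j. \<forall>y\<in>gpart L k. brk L x y \<in> gpart L (j + k)"
    using assms unfolding lie_superalgebra_def by blast
  from this[rule_format, of x 1 y 1]
  show "x \<in> godd L \<Longrightarrow> y \<in> godd L \<Longrightarrow> brk L x y \<in> geven L"
    by (simp add: gpart_def)
qed

context
  fixes G :: lie_sgroup and L :: "'g::real_vector lsa" and lam :: "'g \<Rightarrow> vfield"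
  assumes lam: "lie_algebra_of G L lam"
begin

lemma lam_bij: "k \<in> {0, 1} \<Longrightarrow> bij_betw lam (gpart L k) (left_invariant G k)"
  by (rule lam[unfolded lie_algebra_of_def, THEN conjunct1, THEN bspec])

lemma lam_odd: "x \<in> godd L \<Longrightarrow> lam x \<in> left_invariant G 1"
  using bij_betwE[OF lam_bij[of 1]] by (simp add: gpart_def)

context
  fixes V F
  assumes V: "openin (body (gmfd G)) V" and F: "F \<in> fns (gmfd G) V"
begin

lemma lam_add: "lam (x + y) V F = (\<lambda>i z. lam x V F i z + lam y V F i z)"
  and lam_scaleR: "lam (r *\<^sub>R x) V F = (\<lambda>i z. r *\<^sub>R lam x V F i z)"
  and lam_brk: "j \<in> {0, 1} \<Longrightarrow> k \<in> {0, 1} \<Longrightarrow> x \<in> gpart L j \<Longrightarrow> y \<in> gpart L k \<Longrightarrow> lam (brk L x y) V F =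
    (\<lambda>i z. lam x V (lam y V F) i z - (- 1) ^ (j * k) *\<^sub>R lam y V (lam x V F) i z)"
proof -
  note a = lam[unfolded lie_algebra_of_def, THEN conjunct2, THEN spec, THEN spec, THEN mp, OF conjI[OF V F]]
  show "lam (x + y) V F = (\<lambda>i z. lam x V F i z + lam y V F i z)"
    by (rule a[THEN conjunct1, THEN spec, THEN spec])
  show "lam (r *\<^sub>R x) V F = (\<lambda>i z. r *\<^sub>R lam x V F i z)"
    by (rule a[THEN conjunct2, THEN conjunct1, THEN spec, THEN spec])
  show "j \<in> {0, 1} \<Longrightarrow> k \<in> {0, 1} \<Longrightarrow> x \<in> gpart L j \<Longrightarrow> y \<in> gpart L k \<Longrightarrow> lam (brk L x y) V F =
    (\<lambda>i z. lam x V (lam y V F) i z - (- 1) ^ (j * k) *\<^sub>R lam y V (lam x V F) i z)"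
    by (rule a[THEN conjunct2, THEN conjunct2, THEN bspec, THEN bspec, THEN bspec, THEN bspec])
qed

lemma lam_zero: "lam 0 V F = (\<lambda>i z. 0)"
  using lam_scaleR[of 0 0] by simp

lemma lam_brk_self:
  "x \<in> godd L \<Longrightarrow> lam (brk L x x) V F = (\<lambda>i z. 2 *\<^sub>R lam x V (lam x V F) i z)"
  using lam_brk[of 1 1 x x] by (simp add: gpart_def scaleR_2)

lemma value_lam_sum:
  "value_at (gmfd G) (lam (\<Sum>b\<in>A. c b *\<^sub>R b) V F) x = (\<Sum>b\<in>A. c b * value_at (gmfd G) (lam b V F) x)"
  by (induction A rule: infinite_finite_induct)
    (simp_all add: lam_zero lam_add lam_scaleR value_at_arith)

end

lemma lam_eq_zeroD:
  assumes L: "lie_superalgebra L" and k: "k \<in> {0, 1}" and u: "u \<in> gpart L k"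
    and zero: "\<And>V F. openin (body (gmfd G)) V \<Longrightarrow> F \<in> fns (gmfd G) V \<Longrightarrow> lam u V F = (\<lambda>i z. 0)"
  shows "u = 0"
proof -
  have 0: "0 \<in> gpart L k" using subspace_gparts[OF L] by (simp add: gpart_def subspace_0)
  have "lam v \<in> vfields (gmfd G) k" if "v \<in> gpart L k" for v
    using bij_betwE[OF lam_bij[OF k]] that left_invariant_vfields by blast
  then have "lam u = lam 0"
    using u 0 zero by (intro vfields_eqI[of _ "gmfd G" k _ k]) (simp_all add: lam_zero)
  then show ?thesis
    using lam_bij[OF k] u 0 by (auto simp: bij_betw_def dest: inj_onD)
qed

lemma square_zero_rtrans:
  assumes G: "lie_supergroup G" and L: "lie_superalgebra L"
    and u: "u \<in> godd L" and w: "w \<in> godd L" and h: "h \<in> points (gmfd G)"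
  defines "T \<equiv> times_R01 (gmfd G)"
  assumes eq: "pmult G T (deform (gmfd G) (gmfd G) (pone G T) (lam w)) (const_mor T (gmfd G) h) =
      pmult G T (const_mor T (gmfd G) h) (deform (gmfd G) (gmfd G) (pone G T) (lam u))"
    and zero: "brk L w w = 0"
  shows "brk L u u = 0"
proof (rule lam_eq_zeroD[OF L, of 0])
  show "brk L u u \<in> gpart L 0" using subspace_gparts(4)[OF L u u] by (simp add: gpart_def)
  fix V F assume V: "openin (body (gmfd G)) V" and F: "F \<in> fns (gmfd G) V"
  let ?X = "gmfd G" and ?R = "rtrans G h"
  let ?U = "preim ?X ?R V"
  note int = rtrans_intertwines[OF G h lam_odd[OF u] lam_odd[OF w] eq[unfolded T_def] V]
  note R = rtrans_in_Mor[OF G h]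
  have lu: "lam u \<in> vfields ?X 1" by (rule left_invariant_vfields[OF lam_odd[OF u]])
  have U: "openin (body ?X) ?U" by (rule open_preim[OF R V])
  have uF: "lam u V F \<in> fns ?X V" by (rule vfields_fns[OF lu V F])
  have RF: "pull ?R V F \<in> fns ?X ?U" by (rule Mor_fns[OF R V F])
  have "pull ?R V (lam u V (lam u V F)) = lam w ?U (lam w ?U (pull ?R V F))"
    unfolding int[OF uF] int[OF F] ..
  also have "\<dots> = (\<lambda>i z. 0)"
    using lam_brk_self[OF U RF w] unfolding zero lam_zero[OF U RF] by (simp add: fun_eq_iff)
  finally have "lam u V (lam u V F) = (\<lambda>i z. 0)"
    by (rule rtrans_pull_inj[OF G h V vfields_fns[OF lu V uF]])
  then show "lam (brk L u u) V F = (\<lambda>i z. 0)"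
    unfolding lam_brk_self[OF V F u] by simp
qed simp

end

section \<open>Values of forms at a point\<close>

definition form_value :: "'g::real_vector set \<Rightarrow> nat \<Rightarrow> pt \<Rightarrow> 'g gform \<Rightarrow> 'g" where
  "form_value B i z \<sigma> = (\<Sum>b\<in>B. coeff (\<sigma> b i z) {} *\<^sub>R b)"

lemma form_value_odd:
  assumes L: "lie_superalgebra L" and \<sigma>: "\<sigma> \<in> odd_gforms P L B"
  shows "form_value B i z \<sigma> \<in> godd L"
  unfolding form_value_def
proof (rule subspace_sum[OF subspace_gparts(2)[OF L]])
  fix b assume b: "b \<in> B"
  show "coeff (\<sigma> b i z) {} *\<^sub>R b \<in> godd L"
  proof (cases "b \<in> godd L")
    case True
    then show ?thesis using subspace_gparts(2)[OF L] by (simp add: subspace_scale)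
  next
    case False
    have "invol_sec (\<sigma> b) = (\<lambda>i z. (- 1) ^ (1 + par L b) * \<sigma> b i z)"
      using \<sigma> b by (simp add: odd_gforms_def)
    then have "ginvol (\<sigma> b i z) = - \<sigma> b i z"
      using False by (simp add: invol_sec_def par_def fun_eq_iff)
    then have "coeff (\<sigma> b i z) {} = - coeff (\<sigma> b i z) {}"
      by (metis coeff_ginvol_empty coeff_uminus)
    then show ?thesis using subspace_gparts(2)[OF L] by (simp add: subspace_0)
  qed
qed

lemma form_value_const:
  assumes B: "homogeneous_basis L B" and P: "supermanifold P" and z: "z \<in> cdom P i"
  shows "form_value B i z (const_gform P B C) = C"
proof -
  have "coeff (const_gform P B C b i z) {} = representation B C b" for b
    using z sm_points[OF P] by (auto simp: const_gform_def const_sec_def coeff_of_real)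
  then show ?thesis
    using B unfolding form_value_def homogeneous_basis_def
    by (simp add: sum_representation_eq)
qed

lemma brk_form_value:
  assumes L: "lie_superalgebra L" and B: "homogeneous_basis L B" and zero: "\<And>c. coeff (sq_gform L B \<sigma> c i z) {} = 0"
  shows "brk L (form_value B i z \<sigma>) (form_value B i z \<sigma>) = 0"
proof -
  have ind: "independent B" and sp: "span B = UNIV" and fin: "finite B"
    using B by (simp_all add: homogeneous_basis_def)
  define w where "w b = coeff (\<sigma> b i z) {}" for b
  have inv: "coeff ((invol_sec ^^ k) F i z) {} = coeff (F i z) {}" for k F
    by (induction k) (simp_all add: invol_sec_def)
  have bil: "bilinear (brk L)" by (rule subspace_gparts(3)[OF L])
  have br: "brk L (form_value B i z \<sigma>) (form_value B i z \<sigma>) =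
      (\<Sum>a\<in>B. \<Sum>b\<in>B. (w a * w b) *\<^sub>R brk L a b)"
    unfolding form_value_def w_def bilinear_sum[OF bil] sum.cartesian_product
    by (simp add: bilinear_lmul[OF bil] bilinear_rmul[OF bil] case_prod_unfold mult.commute)
  have rep: "representation B (\<Sum>a\<in>B. \<Sum>b\<in>B. (w a * w b) *\<^sub>R brk L a b) c = 0" for c
  proof -
    have "representation B (\<Sum>a\<in>B. \<Sum>b\<in>B. (w a * w b) *\<^sub>R brk L a b) c =
        (\<Sum>a\<in>B. \<Sum>b\<in>B. (w a * w b) * representation B (brk L a b) c)"
      using ind sp by (simp add: representation_sum representation_scale)
    also have "\<dots> = 2 * coeff (sq_gform L B \<sigma> c i z) {}"
      by (simp add: sq_gform_def brk_gform_def coeff_sum coeff_mult_empty inv w_def mult_ac)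
    finally show ?thesis using zero by simp
  qed
  show ?thesis
    unfolding br using sum_representation_eq[OF ind, of _ B] rep sp fin
    by (metis (no_types, lifting) UNIV_I scale_zero_left subset_refl sum.neutral)
qed

lemma one_plus_eps_const:
  assumes lam: "lie_algebra_of G L lam" and B: "homogeneous_basis L B" and P: "supermanifold P"
    and C: "C \<in> godd L"
  shows "one_plus_eps G lam B P (const_gform P B C) =
    deform P (gmfd G) (pone G (times_R01 P)) (lam C)"
proof (rule mor.equality)
  let ?l = "one_plus_eps G lam B P (const_gform P B C)"
    and ?r = "deform P (gmfd G) (pone G (times_R01 P)) (lam C)"
  have ind: "independent B" and sp: "span B = UNIV" and fin: "finite B"
    using B by (simp_all add: homogeneous_basis_def)
  have Ceq: "(\<Sum>b\<in>B. representation B C b *\<^sub>R b) = C"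
    using ind sp fin by (simp add: sum_representation_eq)
  show "mmap ?l = mmap ?r" by (simp add: one_plus_eps_def pone_def const_mor_def)
  show "pull ?l = pull ?r"
  proof (rule ext, rule ext)
    fix V F
    show "pull ?l V F = pull ?r V F"
    proof (cases "openin (body (gmfd G)) V \<and> F \<in> fns (gmfd G) V")
      case True
      then have V: "openin (body (gmfd G)) V" and F: "F \<in> fns (gmfd G) V" by simp_all
      have DF: "lam C V F \<in> fns (gmfd G) V"
        by (rule vfields_fns[OF left_invariant_vfields[OF lam_odd[OF lam C]] V F])
      let ?v = "\<lambda>H. value_at (gmfd G) H (gunit G)"
      have v: "?v (lam C V F) = (\<Sum>b\<in>B. ?v (lam b V F) * representation B C b)"
        using value_lam_sum[OF lam V F, of "representation B C" B] unfolding Ceq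
        by (simp add: mult.commute)
      have sum: "(\<Sum>b\<in>B. ?v (lam b V F) *\<^sub>R const_gform P B C b i z) =
          (if z \<in> cdom P i then of_real (?v (lam C V F)) else 0)" for i z
        using cdom_points[OF P, of z i]
        by (auto simp: const_gform_def const_sec_def v scaleR_conv_of_real)
      have "pull ?l V F = (\<lambda>i z. if gunit G \<in> V \<and> z \<in> cdom P i then of_real (?v F) +
          gen (odim P) * of_real (?v (lam C V F)) else 0)"
        using True by (auto simp: one_plus_eps_def sum fun_eq_iff)
      also have "\<dots> = pull ?r V F"
        unfolding pull_deform[OF V F] pone_def const_mor_times_R01 pull_const_mor[OF V F]
          pull_const_mor[OF V DF]
        using cdom_points[OF P] by (auto simp: const_sec_def fun_eq_iff)
      finally show ?thesis .
    qed (auto simp: one_plus_eps_def deform_def)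
  qed
qed simp

lemma one_plus_eps_point_mor:
  assumes G: "lie_supergroup G" and L: "lie_superalgebra L" and lam: "lie_algebra_of G L lam"
    and X: "supermanifold X" and P: "supermanifold P"
    and z: "z \<in> cdom P i" and \<sigma>: "\<sigma> \<in> odd_gforms P L B"
    and ope: "one_plus_eps G lam B P \<sigma> \<in> Mor (times_R01 P) (gmfd G)"
  shows "mcomp (times_R01 X) (times_R01 P) (gmfd G) (one_plus_eps G lam B P \<sigma>) (point_mor X P i z) =
    deform X (gmfd G) (pone G (times_R01 X)) (lam (form_value B i z \<sigma>))"
proof (rule Mor_eqI)
  let ?o = "one_plus_eps G lam B P \<sigma>" and ?j = "point_mor X P i z" and ?u = "form_value B i z \<sigma>"
    and ?S = "times_R01 X" and ?T = "times_R01 P"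
  note Gm = group_sm[OF G]
  have u: "lam ?u \<in> vfields (gmfd G) 1"
    by (rule left_invariant_vfields[OF lam_odd[OF lam form_value_odd[OF L \<sigma>]]])
  show "mcomp ?S ?T (gmfd G) ?o ?j \<in> Mor ?S (gmfd G)"
    by (rule mcomp_in_Mor[OF Gm(1) point_mor_in_Mor[OF X P z] ope])
  show "deform X (gmfd G) (pone G ?S) (lam ?u) \<in> Mor ?S (gmfd G)"
    by (rule deform_in_Mor[OF X Gm(1) pone_in_Mor[OF G supermanifold_times_R01[OF X]] u])
  have zP: "z \<in> points P" by (rule cdom_points[OF P z])
  then have mo: "mmap ?o z = gunit G" by (simp add: one_plus_eps_def)
  show "mmap (mcomp ?S ?T (gmfd G) ?o ?j) x = mmap (deform X (gmfd G) (pone G ?S) (lam ?u)) x"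
    if "x \<in> points ?S" for x
    using that by (simp add: mmap_mcomp mmap_point_mor pone_def mmap_const_mor mo)
  show "pull (mcomp ?S ?T (gmfd G) ?o ?j) V F = pull (deform X (gmfd G) (pone G ?S) (lam ?u)) V F"
    if V: "openin (body (gmfd G)) V" and F: "F \<in> fns (gmfd G) V" for V F
  proof -
    let ?v = "\<lambda>H. value_at (gmfd G) H (gunit G)"
    have DF: "lam ?u V F \<in> fns (gmfd G) V" by (rule vfields_fns[OF u V F])
    have iff: "z \<in> preim ?T ?o V \<longleftrightarrow> gunit G \<in> V" using zP mo by (simp add: preim_def)
    have op: "openin (body P) (preim ?T ?o V)" using open_preim[OF ope V] by simp
    have pm: "preim X ?j (preim ?T ?o V) = (if gunit G \<in> V then points X else {})"
      unfolding preim_point_mor iff ..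
    have val: "pull ?o V F i z = of_real (?v F) +
        gen (odim P) * (\<Sum>b\<in>B. ?v (lam b V F) *\<^sub>R \<sigma> b i z)" if "gunit G \<in> V"
      using V F z that by (simp add: one_plus_eps_def)
    have "?v (lam ?u V F) = (\<Sum>b\<in>B. coeff (\<sigma> b i z) {} * ?v (lam b V F))"
      unfolding form_value_def by (rule value_lam_sum[OF lam V F])
    then have co: "coeff (pull ?o V F i z) {} = ?v F" "coeff (pull ?o V F i z) {odim P} = ?v (lam ?u V F)"
      if "gunit G \<in> V"
      unfolding val[OF that] by (simp_all add: coeff_of_real coeff_sum mult.commute)
    show ?thesis
      unfolding pull_mcomp[OF V F] pull_point_mor[OF op Mor_fns[OF ope V F]] pm pull_deform[OF V F]
        pone_def const_mor_times_R01 pull_const_mor[OF V F] pull_const_mor[OF V DF]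
      using co by (cases "gunit G \<in> V") (simp_all add: const_sec_empty)
  qed
qed

section \<open>The exterior derivative at a zero of the fibre coordinates\<close>

lemma ext_d_value:
  assumes V: "openin (body P) V" and F: "F \<in> fns P V"
    and fibre: "\<And>b. coord P i z (edim M + b) = 0"
  shows "coeff (ext_d M P V F i z) {} = 0"
  using V F by (simp add: ext_d_def d_local_def coeff_sum fibre)

lemma PiT_zero_point:
  assumes M: "supermanifold M" and ne: "points M \<noteq> {}" and PiT: "is_PiT M P \<pi>"
  obtains i z where "z \<in> cdom P i" "\<And>b. coord P i z (edim M + b) = 0"
proof -
  obtain x i where x: "x \<in> cdom M i" using ne sm_points[OF M] by auto
  let ?y = "coord M i x"
  have "openin (coord_space (edim M)) (coord M i ` cdom M i)"
    using M by (simp add: supermanifold_def)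
  then have "?y \<in> topspace (coord_space (edim M))"
    using x openin_subset by blast
  then have y: "?y a = 0" if "a \<ge> edim M" for a
    using that by (simp add: coord_space_def)
  have "coord P i ` cdom P i = {y \<in> topspace (coord_space (edim P)).
      (\<lambda>a. if a < edim M then y a else 0) \<in> coord M i ` cdom M i}"
    and edim: "edim P = edim M + odim M"
    using PiT unfolding is_PiT_def by blast+
  moreover have "(\<lambda>a. if a < edim M then ?y a else 0) = ?y"
    using y by (auto simp: fun_eq_iff)
  ultimately have "?y \<in> coord P i ` cdom P i"
    using x y by (simp add: coord_space_def)
  then obtain z where "z \<in> cdom P i" "coord P i z = ?y" by auto
  with y show thesis by (intro that[of z i]) simp_all
qed

theorem proposition3p1:
  fixes M P :: supermfd and \<pi> g :: mor and G :: lie_sgroup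
    and L :: "'g::real_vector lsa" and lam :: "'g \<Rightarrow> vfield" and B :: "'g set"
    and \<omega> \<tau> \<theta> :: "'g gform" and C :: 'g
  assumes "supermanifold M" and "contractible_supermfd M"
    and "is_PiT M P \<pi>"
    and "lie_superalgebra L" and "lie_supergroup G" and "lie_algebra_of G L lam"
    and "homogeneous_basis L B"
    and "\<omega> \<in> odd_gforms P L B" and "maurer_cartan M P L B \<omega>"
    and "g \<in> Mor P (gmfd G)" and "C \<in> godd L"
    and "has_Ad G L lam B P g (const_gform P B C) \<tau>"
    and "has_right_logderiv G L lam B M P g \<theta>"
    and "\<omega> = (\<lambda>b i z. \<tau> b i z - \<theta> b i z)"
  shows "lsa_square L C = 0 \<and> homological L C"
proof -
  note L = assms(4) and G = assms(5) and lam = assms(6) and B = assms(7) and g = assms(10) and C = assms(11)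
  have P: "supermanifold P" and d: "ext_d M P \<in> vfields P 1"
    using assms(3) unfolding is_PiT_def by blast+
  have "points M \<noteq> {}" using assms(2) by (simp add: contractible_supermfd_def)
  then obtain i z where z: "z \<in> cdom P i" and fibre: "\<And>b. coord P i z (edim M + b) = 0"
    using PiT_zero_point[OF assms(1) _ assms(3)] by blast
  define X where "X = gmfd G"
  define S where "S = times_R01 P"
  define T where "T = times_R01 X"
  define j where "j = point_mor X P i z"
  define g' where "g' = mcomp S P X g (pr_R01 P)"
  define g_dg where "g_dg = mcomp S P X g (odd_shift P (ext_d M P))"
  define c where "c = const_mor T X (mmap g z)"
  define u where "u = pinv G S g'"
  define u' where "u' = mcomp T S X u j"
  let ?one = "\<lambda>\<sigma>. one_plus_eps G lam B P \<sigma>" and ?val = "form_value B i z"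
    and ?D = "\<lambda>x. deform X X (pone G T) (lam x)"
  have X: "supermanifold X" unfolding X_def by (rule group_sm[OF G])
  have S: "supermanifold S" and T: "supermanifold T"
    unfolding S_def T_def by (rule supermanifold_times_R01[OF P], rule supermanifold_times_R01[OF X])
  have zP: "z \<in> points P" by (rule cdom_points[OF P z])
  have gX: "g \<in> Mor P X" using g by (simp add: X_def)
  then have h: "mmap g z \<in> points X" using zP by (rule Mor_point)
  have j: "j \<in> Mor T S" unfolding j_def T_def S_def by (rule point_mor_in_Mor[OF X P z])
  have pr: "pr_R01 P \<in> Mor S P" unfolding S_def by (rule pr_R01_in_Mor[OF P])
  have sh: "odd_shift P (ext_d M P) \<in> Mor S P"
    unfolding odd_shift_eq_deform[OF d] S_def by (rule deform_in_Mor[OF P P pr_R01_in_Mor(2)[OF P] d])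
  have g': "g' \<in> Mor S X" and g_dg: "g_dg \<in> Mor S X"
    unfolding g'_def g_dg_def by (rule mcomp_in_Mor[OF X pr gX], rule mcomp_in_Mor[OF X sh gX])
  have u: "u \<in> Mor S X" using pinv_in_Mor[OF G g'[unfolded X_def]] by (simp add: u_def X_def)
  have u': "u' \<in> Mor T X" unfolding u'_def by (rule mcomp_in_Mor[OF X j u])
  have c: "c \<in> Mor T X" unfolding c_def by (rule const_mor_in_Mor[OF T X h])
  have "mcomp T S P (pr_R01 P) j = const_mor T P z"
    unfolding T_def S_def j_def by (rule pr_R01_point_mor[OF X P z])
  then have g'j: "mcomp T S X g' j = c"
    unfolding g'_def mcomp_assoc[OF P X j pr gX, symmetric] c_def
    by (simp add: mcomp_const_mor_right[OF T P X zP gX])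
  have "mcomp T S P (odd_shift P (ext_d M P)) j = const_mor T P z"
    unfolding T_def S_def j_def
    by (rule odd_shift_point_mor[OF X P z d]) (rule ext_d_value[OF _ _ fibre])
  then have g_dgj: "mcomp T S X g_dg j = c"
    unfolding g_dg_def mcomp_assoc[OF P X j sh gX, symmetric] c_def
    by (simp add: mcomp_const_mor_right[OF T P X zP gX])
  note pm = pmult_mcomp[OF G S, folded X_def, OF _ _ T j]
  have ponej: "mcomp T S X (pone G S) j = pone G T"
    using mcomp_const_mor_left[OF T S X gunit_point[OF G, folded X_def] j] by (simp add: pone_def X_def)
  have cu: "pmult G T c u' = pone G T"
    using pm[OF g' u] pmult_pinv[OF G S g'[unfolded X_def]]
    by (simp add: g'j ponej u_def u'_def)
  have uc: "pmult G T u' c = pone G T"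
    using pm[OF u g'] pinv_pmult[OF G S g'[unfolded X_def]]
    by (simp add: g'j ponej u_def u'_def)
  note pmT = pmult_in_Mor[OF G T, folded X_def] and pmS = pmult_in_Mor[OF G S, folded X_def]
  note eval = one_plus_eps_point_mor[OF G L lam X P z, folded T_def S_def j_def X_def]

  have \<theta>: "\<theta> \<in> odd_gforms P L B" and one_\<theta>: "?one \<theta> = pmult G S g_dg u"
    using assms(13) unfolding has_right_logderiv_def Let_def g'_def g_dg_def S_def X_def u_def by simp_all
  have "?D (?val \<theta>) = mcomp T S X (?one \<theta>) j"
    by (rule eval[symmetric, OF \<theta>]) (simp add: one_\<theta> pmS[OF g_dg u])
  also have "\<dots> = pone G T"
    unfolding one_\<theta> pm[OF g_dg u] g_dgj using cu by (simp add: u'_def)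
  finally have D\<theta>: "?D (?val \<theta>) = pone G T" .
  have \<theta>0: "?val \<theta> = 0"
  proof (rule lam_eq_zeroD[OF lam L, of 1])
    show "?val \<theta> \<in> gpart L 1" using form_value_odd[OF L \<theta>] by (simp add: gpart_def)
    show "lam (?val \<theta>) V F = (\<lambda>i z. 0)"
      if "openin (body (gmfd G)) V" "F \<in> fns (gmfd G) V" for V F
      using left_invariant_zero[OF G lam_odd[OF lam form_value_odd[OF L \<theta>]] _ that] D\<theta>
      by (simp add: X_def T_def)
  qed simp

  have \<tau>: "\<tau> \<in> odd_gforms P L B" and C\<sigma>: "const_gform P B C \<in> odd_gforms P L B"
    and one_\<tau>: "?one \<tau> = pmult G S (pmult G S g' (?one (const_gform P B C))) u"
    using assms(12) unfolding has_Ad_def Let_def g'_def S_def X_def u_def by simp_all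
  have lC: "lam C \<in> left_invariant G 1" by (rule lam_odd[OF lam C])
  have oneC: "?one (const_gform P B C) \<in> Mor S X"
    unfolding one_plus_eps_const[OF lam B P C] X_def S_def
    by (rule pmult_deform_pone(1)[OF G P _ lC]) (use g' in \<open>simp add: X_def S_def\<close>)
  have DC: "?D C \<in> Mor T X"
    using pmult_deform_pone(1)[OF G X _ lC] c by (simp add: X_def T_def)
  have "?D (?val \<tau>) = mcomp T S X (?one \<tau>) j"
    by (rule eval[symmetric, OF \<tau>]) (simp add: one_\<tau> pmS[OF pmS[OF g' oneC] u])
  also have "\<dots> = pmult G T (pmult G T c (?D C)) u'"
    unfolding one_\<tau> pm[OF pmS[OF g' oneC] u] pm[OF g' oneC] g'j u'_def[symmetric]
      eval[OF C\<sigma> oneC] form_value_const[OF B P z] ..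
  finally have "pmult G T (?D (?val \<tau>)) c = pmult G T (pmult G T (pmult G T c (?D C)) u') c"
    by simp
  also have "\<dots> = pmult G T c (?D C)"
    using pmult_assoc[OF G T, folded X_def, OF pmT[OF c DC] u' c]
      pmult_pone[OF G T, folded X_def, OF pmT[OF c DC]] by (simp add: uc)
  finally have conj: "pmult G T (?D (?val \<tau>)) c = pmult G T c (?D C)" .

  have "?val \<omega> = ?val \<tau> - ?val \<theta>"
    unfolding assms(14) form_value_def by (simp add: scaleR_diff_left sum_subtractf)
  then have val\<omega>: "?val \<omega> = ?val \<tau>" using \<theta>0 by simp
  have "brk L (?val \<omega>) (?val \<omega>) = 0"
  proof (rule brk_form_value[OF L B])
    fix b
    have "coeff (d_gform M P B \<omega> b i z) {} = 0"
      using assms(8) ext_d_value[OF openin_topspace _ fibre, of "\<omega> b"]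
      by (auto simp: d_gform_def odd_gforms_def)
    moreover have "d_gform M P B \<omega> b i z + sq_gform L B \<omega> b i z = 0"
      using assms(9) by (simp add: maurer_cartan_def)
    ultimately show "coeff (sq_gform L B \<omega> b i z) {} = 0"
      by (metis add_0 coeff_add coeff_zero)
  qed
  then have "brk L C C = 0"
    using square_zero_rtrans[OF lam G L C form_value_odd[OF L \<tau>] h[unfolded X_def]] conj
    by (simp add: val\<omega> X_def T_def c_def)
  then show ?thesis using C by (simp add: lsa_square_def homological_def)
qed

end
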